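(* Let $\mathbf{K}$ be an algebraically closed field of arbitrary characteristic, complete with respect to a non-Archimedean absolute value. Let $X\subset \mathbb{P}^N(\mathbf{K})$ be a projective subvariety of dimension $n\ge 1$ over $\mathbf{K}$. Let $D_1,\dots,D_q$ be hypersurfaces in $\mathbb{P}^N(\mathbf{K})$ in general position with $X$ (in particular $q\ge n+1$). Let $f:\mathbf{K}\to X$ be a non-constant analytic map whose image is not completely contained in any of the hypersurfaces $D_1,\dots,D_q$. Then $$\sum_{j=1}^q\delta_f(D_j)\le n=\dim X.$$
   Context: For an entire function $g(z)=\sum_{j\ge0}a_jz^j$ on $\mathbf{K}$ (a power series with coefficients in $\mathbf{K}$ converging on all of $\mathbf{K}$) and real $r\ge0$, set $|g|_r=\sup_j|a_j|r^j$. A non-constant analytic curve (analytic map) $f:\mathbf{K}\to\mathbb{P}^N(\mathbf{K})$ is given by a reduced representation $\tilde f=(f_0,\dots,f_N)$, where $f_0,\dots,f_N$ are entire functions on $\mathbf{K}$ without common zeros, at least one of which is non-constant. An analytic map $f:\mathbf{K}\to X$ is an analytic curve in $\mathbb{P}^N(\mathbf{K})$ whose image lies in $X$. Fix a reduced representation of $f$ and set $\|f\|_r=\max\{|f_0|_r,\dots,|f_N|_r\}$. The Nevanlinna characteristic function is $T_f(r)=\log\|f\|_r$ (independent, up to an additive constant, of the reduced representation). For a hypersurface $D\subset\mathbb{P}^N(\mathbf{K})$ of degree $d$ defined by a homogeneous form $Q$ of degree $d$ in $N+1$ variables over $\mathbf{K}$, put $Q\circ f=Q(f_0,\dots,f_N)$,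 an entire function. If $Q\circ f\not\equiv0$, the proximity function is $m_f(r,D)=\log\dfrac{\|f\|_r^d}{|Q\circ f|_r}$ (independent, up to an additive constant, of the choice of $Q$). The defect of $D_j$ with respect to $f$ is $\delta_f(D_j)=\liminf_{r\to\infty}\dfrac{m_f(r,D_j)}{(\deg D_j)\,T_f(r)}$. $X$ is not necessarily smooth. A collection of $q\ge n+1$ hypersurfaces $D_1,\dots,D_q$ in $\mathbb{P}^N(\mathbf{K})$, with defining forms $Q_1,\dots,Q_q$, is in general position with the $n$-dimensional projective subvariety $X$ if for every subset $\{i_0,\dots,i_n\}\subset\{1,\dots,q\}$ of cardinality $n+1$ one has $\{x\in X: Q_{i_j}(x)=0,\ j=0,\dots,n\}=\emptyset$. *)

theory Defs
  imports
    "HOL-Analysis.Analysis"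
    "HOL-Computational_Algebra.Computational_Algebra"
    "HOL-Library.Poly_Mapping"
begin

section \<open>Fields with a non-Archimedean absolute value\<close>

text \<open>
  The metric, and with it the topology and the notion of completeness (class
  \<^class>\<open>complete_space\<close>), is the one induced by the absolute value \<open>absv\<close>.  The library's
  \<^class>\<open>real_normed_field\<close> cannot be used, since it forces an algebra structure over the reals.
\<close>

class nonarch_field = field + metric_space +
  fixes absv :: "'a \<Rightarrow> real"
  assumes absv_nonneg: "0 \<le> absv x"
    and absv_eq_zero_iff: "absv x = 0 \<longleftrightarrow> x = 0"
    and absv_mult: "absv (x * y) = absv x * absv y"
    and absv_add: "absv (x + y) \<le> max (absv x) (absv y)"
    and dist_absv: "dist x y = absv (x - y)"


section \<open>Polynomials and forms in several variables\<close>

text \<open>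
  A polynomial is a finitely supported map from exponent vectors to coefficients; the variables
  are indexed by natural numbers.
\<close>

type_synonym 'a mpoly = "(nat \<Rightarrow>\<^sub>0 nat) \<Rightarrow>\<^sub>0 'a"

text \<open>Substitution of \<open>x i\<close> for the \<open>i\<close>-th variable, the coefficients being mapped by \<open>h\<close>.\<close>

definition mpoly_subst ::
    "('a::zero \<Rightarrow> 'b::comm_semiring_1) \<Rightarrow> (nat \<Rightarrow> 'b) \<Rightarrow> 'a mpoly \<Rightarrow> 'b" where
  "mpoly_subst h x Q =
     (\<Sum>m\<in>Poly_Mapping.keys Q. h (Poly_Mapping.lookup Q m) *
        (\<Prod>i\<in>Poly_Mapping.keys m. x i ^ Poly_Mapping.lookup m i))"

abbreviation mpoly_eval :: "(nat \<Rightarrow> 'a::comm_semiring_1) \<Rightarrow> 'a mpoly \<Rightarrow> 'a" where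
  "mpoly_eval \<equiv> mpoly_subst (\<lambda>c. c)"

text \<open>Forms of degree \<open>d\<close> in the \<open>N + 1\<close> variables with indices \<open>0, \<dots>, N\<close> (including zero).\<close>

definition is_form :: "nat \<Rightarrow> nat \<Rightarrow> 'a::zero mpoly \<Rightarrow> bool" where
  "is_form N d Q \<longleftrightarrow>
     (\<forall>m\<in>Poly_Mapping.keys Q. Poly_Mapping.keys m \<subseteq> {..N} \<and>
        (\<Sum>i\<in>Poly_Mapping.keys m. Poly_Mapping.lookup m i) = d)"


section \<open>Projective space and its subvarieties\<close>

text \<open>
  Points are classes of nonzero vectors \<open>(v 0, \<dots>, v N)\<close> modulo scaling; vectors are
  functions on the natural numbers that vanish beyond \<open>N\<close>.
\<close>

definition nonzero_vecs :: "nat \<Rightarrow> (nat \<Rightarrow> 'a::zero) set" where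
  "nonzero_vecs N = {v. (\<forall>i>N. v i = 0) \<and> (\<exists>i\<le>N. v i \<noteq> 0)}"

definition proportional :: "nat \<Rightarrow> ((nat \<Rightarrow> 'a::field) \<times> (nat \<Rightarrow> 'a)) set" where
  "proportional N =
     {(v, w). v \<in> nonzero_vecs N \<and> w \<in> nonzero_vecs N \<and> (\<exists>c. c \<noteq> 0 \<and> w = (\<lambda>i. c * v i))}"

definition proj_space :: "nat \<Rightarrow> (nat \<Rightarrow> 'a::field) set set" where
  "proj_space N = nonzero_vecs N // proportional N"

definition proj_point :: "nat \<Rightarrow> (nat \<Rightarrow> 'a::field) \<Rightarrow> (nat \<Rightarrow> 'a) set" where
  "proj_point N v = proportional N `` {v}"

definition vanishes_at :: "'a::field mpoly \<Rightarrow> (nat \<Rightarrow> 'a) set \<Rightarrow> bool" where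
  "vanishes_at Q P \<longleftrightarrow> (\<forall>v\<in>P. mpoly_eval v Q = 0)"

definition zero_locus :: "nat \<Rightarrow> 'a::field mpoly set \<Rightarrow> (nat \<Rightarrow> 'a) set set" where
  "zero_locus N S = {P \<in> proj_space N. \<forall>Q\<in>S. vanishes_at Q P}"

definition zariski_closed :: "nat \<Rightarrow> (nat \<Rightarrow> 'a::field) set set \<Rightarrow> bool" where
  "zariski_closed N X \<longleftrightarrow> (\<exists>S. (\<forall>Q\<in>S. \<exists>d. is_form N d Q) \<and> X = zero_locus N S)"

definition projective_subvariety :: "nat \<Rightarrow> (nat \<Rightarrow> 'a::field) set set \<Rightarrow> bool" where
  "projective_subvariety N X \<longleftrightarrow>
     zariski_closed N X \<and> X \<noteq> {} \<and>
     (\<forall>A B. zariski_closed N A \<longrightarrow> zariski_closed N B \<longrightarrow> X = A \<union> B \<longrightarrow> X = A \<or> X = B)"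

text \<open>Krull dimension: the supremum of the lengths of chains of irreducible closed subsets.\<close>

definition variety_dim :: "nat \<Rightarrow> (nat \<Rightarrow> 'a::field) set set \<Rightarrow> enat" where
  "variety_dim N X =
     Sup {enat k |k. \<exists>Z. (\<forall>i\<le>k. projective_subvariety N (Z i) \<and> Z i \<subseteq> X) \<and>
                          (\<forall>i<k. Z i \<subset> Z (Suc i))}"

text \<open>
  A hypersurface of degree \<open>d\<close> is given by its defining form, which need not be reduced; its
  set of points is \<open>zero_locus N {Q}\<close>.
\<close>

definition hypersurface_form :: "nat \<Rightarrow> nat \<Rightarrow> 'a::field mpoly \<Rightarrow> bool" where
  "hypersurface_form N d Q \<longleftrightarrow> 1 \<le> d \<and> Q \<noteq> 0 \<and> is_form N d Q"

definition general_position ::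
    "nat \<Rightarrow> (nat \<Rightarrow> 'a::field) set set \<Rightarrow> nat \<Rightarrow> nat \<Rightarrow> (nat \<Rightarrow> 'a mpoly) \<Rightarrow> bool" where
  "general_position N X n q Q \<longleftrightarrow>
     n + 1 \<le> q \<and>
     (\<forall>I. I \<subseteq> {1..q} \<longrightarrow> card I = n + 1 \<longrightarrow> X \<inter> zero_locus N (Q ` I) = {})"


section \<open>Entire functions and analytic curves\<close>

definition entire :: "'a::nonarch_field fps \<Rightarrow> bool" where
  "entire g \<longleftrightarrow> (\<forall>z. summable (\<lambda>j. fps_nth g j * z ^ j))"

definition entire_eval :: "'a::nonarch_field fps \<Rightarrow> 'a \<Rightarrow> 'a" where
  "entire_eval g z = suminf (\<lambda>j. fps_nth g j * z ^ j)"

definition gauss_norm :: "'a::nonarch_field fps \<Rightarrow> real \<Rightarrow> real" where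
  "gauss_norm g r = (SUP j. absv (fps_nth g j) * r ^ j)"

text \<open>
  \<open>F\<close> is a reduced representation of the non-constant analytic curve \<open>f\<close> in projective
  \<open>N\<close>-space; only the components \<open>F 0, \<dots>, F N\<close> matter.
\<close>

definition reduced_rep ::
    "nat \<Rightarrow> (nat \<Rightarrow> 'a::nonarch_field fps) \<Rightarrow> ('a \<Rightarrow> (nat \<Rightarrow> 'a) set) \<Rightarrow> bool" where
  "reduced_rep N F f \<longleftrightarrow>
     (\<forall>i\<le>N. entire (F i)) \<and>
     (\<forall>z. \<exists>i\<le>N. entire_eval (F i) z \<noteq> 0) \<and>
     (\<exists>i\<le>N. \<exists>z w. entire_eval (F i) z \<noteq> entire_eval (F i) w) \<and>
     (\<forall>z. f z = proj_point N (\<lambda>i. if i \<le> N then entire_eval (F i) z else 0))"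


section \<open>Nevanlinna functions\<close>

definition curve_norm :: "nat \<Rightarrow> (nat \<Rightarrow> 'a::nonarch_field fps) \<Rightarrow> real \<Rightarrow> real" where
  "curve_norm N F r = Max ((\<lambda>i. gauss_norm (F i) r) ` {..N})"

definition characteristic :: "nat \<Rightarrow> (nat \<Rightarrow> 'a::nonarch_field fps) \<Rightarrow> real \<Rightarrow> real" where
  "characteristic N F r = ln (curve_norm N F r)"

definition form_compose :: "'a::nonarch_field mpoly \<Rightarrow> (nat \<Rightarrow> 'a fps) \<Rightarrow> 'a fps" where
  "form_compose Q F = mpoly_subst fps_const F Q"

definition proximity ::
    "nat \<Rightarrow> (nat \<Rightarrow> 'a::nonarch_field fps) \<Rightarrow> nat \<Rightarrow> 'a mpoly \<Rightarrow> real \<Rightarrow> real" where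
  "proximity N F d Q r = ln (curve_norm N F r ^ d / gauss_norm (form_compose Q F) r)"

definition defect ::
    "nat \<Rightarrow> (nat \<Rightarrow> 'a::nonarch_field fps) \<Rightarrow> nat \<Rightarrow> 'a mpoly \<Rightarrow> ereal" where
  "defect N F d Q =
     Liminf at_top (\<lambda>r. ereal (proximity N F d Q r / (real d * characteristic N F r)))"

end

theory Submission
  imports Defs "HOL-Library.Function_Algebras"
begin

text \<open>
  If the hypersurfaces \<open>Q\<^sub>j = 0\<close>, \<open>j \<in> I\<close>, have no common point on \<open>X\<close>, then by the Nullstellensatz,
  applied in the affine chart \<open>x\<^sub>k = 1\<close>, the constant \<open>1\<close> is a combination of the \<open>Q\<^sub>j\<close>,
  of equations of \<open>X\<close> and of \<open>x\<^sub>k - 1\<close>.  Pulling this back along the curve and clearing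
  denominators gives an identity \<open>F\<^sub>k\<^sup>M = (\<Sum>j\<in>I. H\<^sub>j Q\<^sub>j(F))\<close> of entire functions; for radii at which
  \<open>F\<^sub>k\<close> has the maximal Gauss norm, the ultrametric inequality shows that the proximity to one of
  the hypersurfaces in \<open>I\<close> is bounded.  In general position this leaves, at every radius, at
  most \<open>n\<close> hypersurfaces with unbounded proximity, and each of these contributes at most
  \<open>d\<^sub>j T(r) + O(1)\<close>.
\<close>

section \<open>The weak Nullstellensatz for polynomial functions\<close>

text \<open>A bare identity for \<open>1\<close> would not do: the estimate also needs coefficients
  that grow no faster than powers of the norm of the curve. The ideal is therefore not given by
  generators. It is \<open>controlled\<close>, the set of functions whose pullback to the chart,
  times a power of \<open>F k\<close>, is a combination of the \<open>Q j\<close> with coefficients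
  of controlled growth. It is closed under the ideal operations, so the Nullstellensatz puts
  \<open>1\<close> into it, and the growth estimate comes along without any degree bound. The chart
  says nothing about points where \<open>F k\<close> vanishes; a further power of \<open>F k\<close>
  makes both sides of the identity vanish there, so that it holds at all points and hence between
  power series. The absolute value may be trivial, and then no element exceeds a given real radius;
  entire functions are treated as polynomials in that case.\<close>

lemma infinite_UNIV_alg_closed_field: "infinite (UNIV :: 'a::alg_closed_field set)"
proof
  assume fin: "finite (UNIV :: 'a set)"
  define p :: "'a poly" where "p = (\<Prod>a\<in>UNIV. [:- a, 1:])"
  have "degree p = card (UNIV :: 'a set)"
    unfolding p_def by (subst degree_prod_eq_sum_degree) auto
  hence "degree p > 0"
    using fin by (simp add: card_gt_0_iff)
  hence "degree (p + 1) > 0"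
    by (simp add: degree_add_eq_left)
  then obtain x where "poly (p + 1) x = 0"
    using alg_closed_imp_poly_has_root by blast
  moreover have "poly p x = 0"
    unfolding p_def poly_prod using fin by (intro prod_zero) auto
  ultimately show False by simp
qed

text \<open>
  A point \<open>\<phi>\<close> of the ring \<open>B\<close> on which \<open>B \<inter> I\<close> vanishes; it is to be extended to \<open>B[x]\<close>.
\<close>

locale point_extension =
  fixes B I :: "'c::comm_ring_1 set" and \<phi> :: "'c \<Rightarrow> 'k::alg_closed_field"
    and \<kappa> :: "'k \<Rightarrow> 'c" and x :: 'c
  assumes B_one: "1 \<in> B"
    and B_const: "\<kappa> c \<in> B"
    and B_add: "a \<in> B \<Longrightarrow> b \<in> B \<Longrightarrow> a + b \<in> B"
    and B_uminus: "a \<in> B \<Longrightarrow> - a \<in> B"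
    and B_mult: "a \<in> B \<Longrightarrow> b \<in> B \<Longrightarrow> a * b \<in> B"
    and I_zero: "0 \<in> I"
    and I_add: "p \<in> I \<Longrightarrow> q \<in> I \<Longrightarrow> p + q \<in> I"
    and I_mult: "b \<in> B \<Longrightarrow> p \<in> I \<Longrightarrow> b * p \<in> I"
    and I_mult_x: "p \<in> I \<Longrightarrow> x * p \<in> I"
    and \<phi>_add: "\<phi> (a + b) = \<phi> a + \<phi> b"
    and \<phi>_mult: "\<phi> (a * b) = \<phi> a * \<phi> b"
    and \<phi>_const: "\<phi> (\<kappa> c) = c"
    and \<phi>_vanish: "b \<in> B \<Longrightarrow> b \<in> I \<Longrightarrow> \<phi> b = 0"
begin

text \<open>The preimage of \<open>I\<close> under B[X] \<rightarrow> B[x]. A value \<open>t\<close>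
  for \<open>x\<close> extends \<open>\<phi>\<close> to a zero of \<open>I\<close> when it is a root
  of all specialised relations, which form an ideal of k[X].\<close>

definition relations :: "'c poly set" where
  "relations = {p. (\<forall>i. coeff p i \<in> B) \<and> poly p x \<in> I}"

abbreviation spec :: "'c poly \<Rightarrow> 'k poly" where
  "spec \<equiv> map_poly \<phi>"

lemma \<phi>_zero [simp]: "\<phi> 0 = 0"
  using \<phi>_add[of 0 0] by (metis add_0 add_cancel_right_right)

lemma \<phi>_one [simp]: "\<phi> 1 = 1"
  using \<phi>_mult[of "\<kappa> 1" 1] by (simp add: \<phi>_const)

lemma \<phi>_uminus: "\<phi> (- a) = - \<phi> a"
  using \<phi>_add[of a "- a"] by (simp add: eq_neg_iff_add_eq_0 add.commute)

lemma \<phi>_sum: "\<phi> (sum f A) = (\<Sum>i\<in>A. \<phi> (f i))"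
  by (induction A rule: infinite_finite_induct) (simp_all add: \<phi>_add)

lemma B_zero: "0 \<in> B"
  using B_add[OF B_one B_uminus[OF B_one]] by simp

lemma B_sum: "(\<And>i. i \<in> A \<Longrightarrow> f i \<in> B) \<Longrightarrow> sum f A \<in> B"
  by (induction A rule: infinite_finite_induct) (simp_all add: B_zero B_add)

lemma coeff_spec [simp]: "coeff (spec p) i = \<phi> (coeff p i)"
  by (simp add: coeff_map_poly)

lemma spec_add: "spec (p + q) = spec p + spec q"
  by (rule poly_eqI) (simp add: \<phi>_add)

lemma spec_mult: "spec (p * q) = spec p * spec q"
  by (rule poly_eqI) (simp add: coeff_mult \<phi>_sum \<phi>_mult)

lemma spec_uminus: "spec (- p) = - spec p"
  by (rule poly_eqI) (simp add: \<phi>_uminus)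

lemma relations_add: "p \<in> relations \<Longrightarrow> q \<in> relations \<Longrightarrow> p + q \<in> relations"
  by (auto simp: relations_def B_add I_add)

lemma I_mult_poly: "(\<And>i. coeff p i \<in> B) \<Longrightarrow> y \<in> I \<Longrightarrow> poly p x * y \<in> I"
proof (induction p)
  case 0
  then show ?case by (simp add: I_zero)
next
  case (pCons a p)
  have "coeff p i \<in> B" for i
    using pCons.prems(1)[of "Suc i"] by simp
  hence "poly p x * y \<in> I"
    using pCons.IH pCons.prems(2) by blast
  moreover have "a \<in> B"
    using pCons.prems(1)[of 0] by simp
  ultimately show ?case
    using I_add[OF I_mult[OF \<open>a \<in> B\<close> pCons.prems(2)] I_mult_x[of "poly p x * y"]]
    by (simp add: algebra_simps)
qed

lemma relations_mult:
  assumes "\<And>i. coeff p i \<in> B" "q \<in> relations"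
  shows "p * q \<in> relations"
  using assms I_mult_poly[of p "poly q x"]
  by (auto simp: relations_def coeff_mult intro!: B_sum B_mult)

lemma relations_uminus: "p \<in> relations \<Longrightarrow> - p \<in> relations"
  using relations_mult[of "[:-1:]" p] B_uminus[OF B_one] B_zero
  by (simp add: coeff_pCons split: nat.splits)

text \<open>
  Pseudo-division by \<open>g\<close> of the relations \<open>X\<^sup>e f\<close> yields relations of ever smaller degree with
  nonvanishing specialised leading coefficient, in the end one of degree \<open>0\<close>.
\<close>

lemma no_constant_relation:
  assumes f: "f \<in> relations" "spec f = [:c:]" "c \<noteq> 0"
  shows "g \<in> relations \<Longrightarrow> degree g \<le> e \<Longrightarrow> \<phi> (coeff g e) \<noteq> 0 \<Longrightarrow> False"
proof (induction e arbitrary: g)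
  case 0
  then obtain b where "g = [:b:]"
    by (metis degree_eq_zeroE le_zero_eq)
  with 0 show False
    using \<phi>_vanish[of b] by (auto simp: relations_def dest: spec[of _ 0])
next
  case (Suc e)
  define u where "u = coeff g (Suc e)"
  have Bg: "coeff g i \<in> B" for i
    using Suc.prems(1) by (auto simp: relations_def)
  have no_monom: False if "p \<in> relations" "spec p = monom c' e" "c' \<noteq> 0" for p c'
    using that
  proof (induction "degree p" arbitrary: p c' rule: less_induct)
    case less
    show False
    proof (cases "degree p \<le> e")
      case True
      have "\<phi> (coeff p e) = c'"
        using arg_cong[OF less.prems(2), of "\<lambda>q. coeff q e"] by simp
      with True show False
        using Suc.IH[of p] less.prems by auto
    next
      case False
      define k where "k = degree p"
      define l where "l = coeff p k"
      \<comment> \<open>The coefficient \<open>l\<close> is killed by \<open>\<phi>\<close>, as its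
        index lies above \<open>e\<close>. So the subtracted multiple of \<open>g\<close> cancels
        the leading term but specialises to zero, and the specialisation of \<open>p\<close> is
        merely scaled by \<open>\<phi> u\<close>.\<close>
      define p' where "p' = [:u:] * p + - (monom l (k - Suc e) * g)"
      have k: "Suc e \<le> k" using False by (simp add: k_def)
      have "l \<in> B" using less.prems(1) by (auto simp: l_def relations_def)
      have "\<phi> l = 0"
        using arg_cong[OF less.prems(2), of "\<lambda>q. coeff q k"] k by (simp add: l_def)
      have "p' \<in> relations"
        unfolding p'_def
        by (intro relations_add relations_uminus relations_mult)
           (use less.prems(1) Suc.prems(1) \<open>l \<in> B\<close> Bg B_zero
             in \<open>auto simp: u_def coeff_pCons split: nat.splits\<close>)
      moreover have "spec p' = monom (\<phi> u * c') e"
        unfolding p'_def spec_add spec_mult spec_uminus using \<open>\<phi> l = 0\<close> less.prems(2)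
        by (simp add: map_poly_monom map_poly_pCons smult_monom)
      moreover have "\<phi> u * c' \<noteq> 0"
        using Suc.prems(3) less.prems(3) by (simp add: u_def)
      moreover have "degree p' < degree p"
      proof -
        have "coeff p' j = 0" if "j \<ge> k" for j
        proof (cases "j = k")
          case True
          then show ?thesis
            using k by (simp add: p'_def coeff_monom_mult l_def u_def)
        next
          case False
          hence "coeff p j = 0" "coeff g (j - (k - Suc e)) = 0"
            using that k Suc.prems(2) by (auto simp: k_def intro!: coeff_eq_0)
          then show ?thesis
            using that by (simp add: p'_def coeff_monom_mult)
        qed
        hence "degree p' \<le> k - 1"
          using k by (intro degree_le) auto
        thus ?thesis using k by (simp add: k_def)
      qed
      ultimately show False using less.hyps by blast
    qed
  qed
  have "monom 1 e * f \<in> relations"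
    using B_one B_zero f by (intro relations_mult) auto
  moreover have "spec (monom 1 e * f) = monom c e"
    unfolding spec_mult using f(2)
    by (simp add: map_poly_monom) (simp add: mult.commute[of _ "[:c:]"] smult_monom)
  ultimately show False
    using no_monom f(3) by blast
qed

text \<open>The specialised relations form an ideal of k[X], generated by a member of least degree,
  and any root of that member will do. The surviving leading coefficient of \<open>g\<close> rules
  out a nonzero constant: for b x = 1 with \<open>\<phi> b = 0\<close> there is no value for
  \<open>x\<close>.\<close>

lemma extend:
  assumes g: "g \<in> relations" "\<phi> (lead_coeff g) \<noteq> 0"
  shows "\<exists>t. \<forall>p\<in>relations. poly (spec p) t = 0"
proof -
  have nz: "spec g \<noteq> 0"
    using g(2) by (metis coeff_spec coeff_0)
  obtain p where p: "p \<in> relations" "spec p \<noteq> 0"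
    and min: "\<And>q. q \<in> relations \<Longrightarrow> spec q \<noteq> 0 \<Longrightarrow> degree (spec p) \<le> degree (spec q)"
    using ex_has_least_nat[of "\<lambda>p. p \<in> relations \<and> spec p \<noteq> 0" g "\<lambda>p. degree (spec p)"]
      g(1) nz by blast
  have dvd: "spec p dvd spec q" if q: "q \<in> relations" for q
  proof -
    \<comment> \<open>\<open>\<kappa>\<close> lifts the quotient to B[X], so the remainder is again
      a specialised relation and minimality makes it zero.\<close>
    define D' where "D' = Poly (map \<kappa> (coeffs (spec q div spec p)))"
    have D': "coeff D' i \<in> B" "\<phi> (coeff D' i) = coeff (spec q div spec p) i" for i
      unfolding D'_def coeff_Poly_eq nth_default_coeffs_eq[symmetric]
      by (auto simp: nth_default_def B_const B_zero \<phi>_const)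
    hence "spec D' = spec q div spec p"
      by (intro poly_eqI) simp
    hence "spec (q + - (D' * p)) = spec q mod spec p"
      unfolding spec_add spec_uminus spec_mult by (simp add: minus_div_mult_eq_mod[symmetric])
    moreover have "q + - (D' * p) \<in> relations"
      using D' p q by (intro relations_add relations_uminus relations_mult) auto
    ultimately have "spec q mod spec p = 0"
      using min[of "q + - (D' * p)"] degree_mod_less[OF p(2), of "spec q"] by force
    thus ?thesis by auto
  qed
  have "degree (spec p) > 0"
  proof (rule ccontr)
    assume "\<not> degree (spec p) > 0"
    then obtain c where "spec p = [:c:]"
      by (meson degree_eq_zeroE neq0_conv)
    with p no_constant_relation[OF p(1) this _ g(1) order_refl g(2)] show False
      by auto
  qed
  then obtain t where "poly (spec p) t = 0"
    using alg_closed_imp_poly_has_root by blast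
  thus ?thesis
    using dvd by (meson dvd_trans poly_eq_0_iff_dvd)
qed

end

section \<open>Polynomial functions and their zeros\<close>

text \<open>Polynomials are represented by the functions that they define, with pointwise
  operations, so that evaluation is application; over an infinite field this loses nothing. The set
  \<open>A\<close> holds the variables that may occur, while points assign values to all
  indices.\<close>

inductive_set polyfun :: "'i set \<Rightarrow> (('i \<Rightarrow> 'a::comm_ring_1) \<Rightarrow> 'a) set" for A where
  const: "(\<lambda>v. c) \<in> polyfun A"
| var: "i \<in> A \<Longrightarrow> (\<lambda>v. v i) \<in> polyfun A"
| add: "p \<in> polyfun A \<Longrightarrow> q \<in> polyfun A \<Longrightarrow> p + q \<in> polyfun A"
| mult: "p \<in> polyfun A \<Longrightarrow> q \<in> polyfun A \<Longrightarrow> p * q \<in> polyfun A"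

lemma polyfun_mono: "p \<in> polyfun A \<Longrightarrow> A \<subseteq> A' \<Longrightarrow> p \<in> polyfun A'"
  by (induction rule: polyfun.induct) (auto intro: polyfun.intros)

lemma polyfun_zero: "0 \<in> polyfun A"
  using polyfun.const[of 0] by (simp add: zero_fun_def)

lemma polyfun_one: "1 \<in> polyfun A"
  using polyfun.const[of 1] by (simp add: one_fun_def)

lemma polyfun_uminus: "p \<in> polyfun A \<Longrightarrow> - p \<in> polyfun A"
  using polyfun.mult[OF polyfun.const[of "- 1"], of p A]
  by (simp add: times_fun_def fun_Compl_def)

lemma polyfun_sum: "(\<And>i. i \<in> S \<Longrightarrow> f i \<in> polyfun A) \<Longrightarrow> sum f S \<in> polyfun A"
  by (induction S rule: infinite_finite_induct) (auto intro: polyfun.intros polyfun_zero)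

lemma polyfun_prod: "(\<And>i. i \<in> S \<Longrightarrow> f i \<in> polyfun A) \<Longrightarrow> prod f S \<in> polyfun A"
  by (induction S rule: infinite_finite_induct) (auto intro: polyfun.intros polyfun_one)

lemma polyfun_cong: "p \<in> polyfun A \<Longrightarrow> (\<And>i. i \<in> A \<Longrightarrow> v i = w i) \<Longrightarrow> p v = p w"
  by (induction rule: polyfun.induct) auto

lemma polyfun_empty: "p \<in> polyfun {} \<Longrightarrow> \<exists>c. p = (\<lambda>v. c)"
  using polyfun_cong[of p "{}"] by blast

text \<open>Supplies the presentation as B[x], with B = \<open>polyfun A\<close>, on which
  \<open>point_extension\<close> works. The coefficients of \<open>P\<close> are functions, and
  \<open>P\<close> is evaluated in the ring of functions at a coordinate function.\<close>

lemma polyfun_insert: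
  "p \<in> polyfun (insert i A) \<Longrightarrow>
     \<exists>P. (\<forall>j. coeff P j \<in> polyfun A) \<and> p = poly P (\<lambda>v. v i)"
proof (induction rule: polyfun.induct)
  case (const c)
  then show ?case
    by (intro exI[of _ "[:\<lambda>v. c:]"])
       (auto simp: coeff_pCons polyfun_zero intro: polyfun.intros split: nat.splits)
next
  case (var j)
  show ?case
  proof (cases "j = i")
    case True
    then show ?thesis
      by (intro exI[of _ "[:0, 1:]"])
         (auto simp: coeff_pCons polyfun_zero polyfun_one split: nat.splits)
  next
    case False
    then show ?thesis using var
      by (intro exI[of _ "[:\<lambda>v. v j:]"])
         (auto simp: coeff_pCons polyfun_zero intro: polyfun.intros split: nat.splits)
  qed
next
  case (add p q)
  then obtain P Q where "\<forall>j. coeff P j \<in> polyfun A" "p = poly P (\<lambda>v. v i)"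
    "\<forall>j. coeff Q j \<in> polyfun A" "q = poly Q (\<lambda>v. v i)" by auto
  then show ?case
    by (intro exI[of _ "P + Q"] conjI allI) (simp_all only: coeff_add poly_add polyfun.add)
next
  case (mult p q)
  then obtain P Q where "\<forall>j. coeff P j \<in> polyfun A" "p = poly P (\<lambda>v. v i)"
    "\<forall>j. coeff Q j \<in> polyfun A" "q = poly Q (\<lambda>v. v i)" by auto
  then show ?case
    by (intro exI[of _ "P * Q"] conjI allI)
       (simp_all only: coeff_mult poly_mult polyfun.mult polyfun_sum)
qed

lemma poly_fun_apply: "poly P f v = poly (map_poly (\<lambda>p. p v) P) (f v)"
  by (induction P) (simp_all add: map_poly_pCons)

lemma polyfun_line:
  fixes p :: "('i \<Rightarrow> 'a::comm_ring_1) \<Rightarrow> 'a"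
  shows "p \<in> polyfun A \<Longrightarrow> \<exists>P. \<forall>t. p (\<lambda>i. v i + t * (w i - v i)) = poly P t"
proof (induction rule: polyfun.induct)
  case (const c)
  then show ?case by (intro exI[of _ "[:c:]"]) auto
next
  case (var i)
  then show ?case by (intro exI[of _ "[:v i, w i - v i:]"]) auto
next
  case (add p q)
  then obtain P Q where "\<forall>t. p (\<lambda>i. v i + t * (w i - v i)) = poly P t"
    "\<forall>t. q (\<lambda>i. v i + t * (w i - v i)) = poly Q t" by blast
  then show ?case by (intro exI[of _ "P + Q"]) simp
next
  case (mult p q)
  then obtain P Q where "\<forall>t. p (\<lambda>i. v i + t * (w i - v i)) = poly P t"
    "\<forall>t. q (\<lambda>i. v i + t * (w i - v i)) = poly Q t" by blast
  then show ?case by (intro exI[of _ "P * Q"]) simp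
qed

text \<open>Restrict to a line joining a point where \<open>p\<close> does not vanish to one where \<open>q\<close> does not.\<close>

lemma polyfun_mult_nonzero:
  fixes p q :: "('i \<Rightarrow> 'a::field) \<Rightarrow> 'a"
  assumes inf: "infinite (UNIV :: 'a set)"
    and "p \<in> polyfun A" "q \<in> polyfun A" "p \<noteq> 0" "q \<noteq> 0"
  shows "p * q \<noteq> 0"
proof
  assume 0: "p * q = 0"
  obtain v w where vw: "p v \<noteq> 0" "q w \<noteq> 0"
    using assms by (auto simp: fun_eq_iff)
  obtain P Q where P: "\<And>t. p (\<lambda>i. v i + t * (w i - v i)) = poly P t"
    and Q: "\<And>t. q (\<lambda>i. v i + t * (w i - v i)) = poly Q t"
    using polyfun_line[OF assms(2), of v w] polyfun_line[OF assms(3), of v w] by auto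
  have "P \<noteq> 0" using P[of 0] vw by auto
  moreover have "Q \<noteq> 0" using Q[of 1] vw by auto
  moreover have "poly (P * Q) t = 0" for t
    using fun_cong[OF 0, of "\<lambda>i. v i + t * (w i - v i)"] by (simp add: P Q)
  hence "P * Q = 0"
    using poly_roots_finite[of "P * Q"] inf by auto
  ultimately show False by simp
qed

lemma polyfun_common_nonzero:
  fixes p :: "'j \<Rightarrow> ('i \<Rightarrow> 'a::field) \<Rightarrow> 'a"
  assumes inf: "infinite (UNIV :: 'a set)"
    and "finite S" "\<And>j. j \<in> S \<Longrightarrow> p j \<in> polyfun A" "\<And>j. j \<in> S \<Longrightarrow> p j \<noteq> 0"
  shows "\<exists>v. \<forall>j\<in>S. p j v \<noteq> 0"
proof -
  have "prod p S \<noteq> 0"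
    using assms(2-)
  proof (induction S)
    case (insert j S)
    then have "p j * prod p S \<noteq> 0"
      by (intro polyfun_mult_nonzero[OF inf, of _ A] polyfun_prod) blast+
    thus ?case unfolding prod.insert[OF insert.hyps] .
  qed simp
  then obtain v where "prod p S v \<noteq> 0" by (auto simp: fun_eq_iff)
  moreover have "prod p S v = (\<Prod>j\<in>S. p j v)"
    by (induction S rule: infinite_finite_induct) auto
  ultimately show ?thesis
    using \<open>finite S\<close> by (metis prod_zero)
qed

text \<open>
  A maximal subset \<open>T\<close> of the variables that is algebraically independent modulo \<open>I\<close> plays the
  role of a Noether normalisation: every other variable satisfies a relation modulo \<open>I\<close> whose
  leading coefficient involves \<open>T\<close> only, and a point of \<open>K\<^sup>T\<close> avoiding the zeros of
  these leading coefficients extends variable by variable.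
\<close>

theorem weak_nullstellensatz:
  fixes I :: "(('i \<Rightarrow> 'k::alg_closed_field) \<Rightarrow> 'k) set"
  assumes fin: "finite A"
    and I_zero: "0 \<in> I"
    and I_add: "\<And>p q. p \<in> I \<Longrightarrow> q \<in> I \<Longrightarrow> p + q \<in> I"
    and I_mult: "\<And>b p. b \<in> polyfun A \<Longrightarrow> p \<in> I \<Longrightarrow> b * p \<in> I"
    and proper: "1 \<notin> I"
  shows "\<exists>v. \<forall>p \<in> I \<inter> polyfun A. p v = 0"
proof -
  define \<T> where "\<T> = {T. T \<subseteq> A \<and> I \<inter> polyfun T \<subseteq> {0}}"
  have "p = 0" if p: "p \<in> I" "p \<in> polyfun {}" for p
  proof (rule ccontr)
    assume "p \<noteq> 0"
    obtain c where c: "p = (\<lambda>v. c)" using polyfun_empty p by blast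
    with \<open>p \<noteq> 0\<close> have "(\<lambda>v. inverse c) * p = 1" by (auto simp: fun_eq_iff)
    thus False using I_mult[OF polyfun.const p(1), of "inverse c"] proper by simp
  qed
  hence "{} \<in> \<T>" by (auto simp: \<T>_def)
  moreover have "finite \<T>"
    using fin by (rule finite_subset[rotated, OF finite_Pow_iff[THEN iffD2]]) (auto simp: \<T>_def)
  ultimately obtain T where T: "T \<in> \<T>" and Tmax: "\<And>T'. T' \<in> \<T> \<Longrightarrow> T \<subseteq> T' \<Longrightarrow> T = T'"
    using finite_has_maximal[of \<T>] by blast
  have "\<exists>P. (\<forall>j. coeff P j \<in> polyfun T) \<and> poly P (\<lambda>v. v i) \<in> I \<and> P \<noteq> 0" if i: "i \<in> A - T" for i
  proof -
    have "insert i T \<notin> \<T>" using Tmax[of "insert i T"] i by auto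
    then obtain p where p: "p \<in> I" "p \<in> polyfun (insert i T)" "p \<noteq> 0"
      using i T by (auto simp: \<T>_def)
    obtain P where "\<forall>j. coeff P j \<in> polyfun T" "p = poly P (\<lambda>v. v i)"
      using polyfun_insert[OF p(2)] by blast
    with p show ?thesis by (intro exI[of _ P]) auto
  qed
  then obtain P where P: "\<And>i j. i \<in> A - T \<Longrightarrow> coeff (P i) j \<in> polyfun T"
    "\<And>i. i \<in> A - T \<Longrightarrow> poly (P i) (\<lambda>v. v i) \<in> I" "\<And>i. i \<in> A - T \<Longrightarrow> P i \<noteq> 0"
    by metis
  have "\<exists>a. \<forall>i\<in>A - T. lead_coeff (P i) a \<noteq> 0"
    using fin P by (intro polyfun_common_nonzero[OF infinite_UNIV_alg_closed_field, of _ _ T])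
      (simp_all add: leading_coeff_neq_0)
  then obtain a where a: "\<And>i. i \<in> A - T \<Longrightarrow> lead_coeff (P i) a \<noteq> 0"
    by blast
  \<comment> \<open>The point is never changed on \<open>T\<close>: the leading coefficients depend
    on \<open>T\<close> only, hence keep their nonzero values at \<open>a\<close> in every
    extension. For empty \<open>S\<close> the point \<open>a\<close> itself serves, as
    \<open>I\<close> contains no nonzero polynomial function of the variables in
    \<open>T\<close>.\<close>
  have "\<exists>v. (\<forall>i\<in>T. v i = a i) \<and> (\<forall>p \<in> I \<inter> polyfun (T \<union> S). p v = 0)"
    if "finite S" "S \<subseteq> A - T" for S
    using that
  proof (induction S)
    case empty
    then show ?case using T by (auto simp: \<T>_def intro!: exI[of _ a])
  next
    case (insert i S)
    then obtain v where v: "\<And>j. j \<in> T \<Longrightarrow> v j = a j"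
      and vI: "\<And>p. p \<in> I \<Longrightarrow> p \<in> polyfun (T \<union> S) \<Longrightarrow> p v = 0"
      by auto
    have TS: "T \<union> S \<subseteq> A" "i \<in> A" "i \<notin> T \<union> S"
      using T insert by (auto simp: \<T>_def)
    interpret point_extension "polyfun (T \<union> S)" I "\<lambda>p. p v" "\<lambda>c v. c" "\<lambda>v. v i"
    proof
      show "b * p \<in> I" if "b \<in> polyfun (T \<union> S)" "p \<in> I" for b p
        using I_mult[OF polyfun_mono] TS(1) that by blast
      show "(\<lambda>v. v i) * p \<in> I" if "p \<in> I" for p
        using I_mult[OF polyfun.var] TS(2) that by blast
      show "1 \<in> polyfun (T \<union> S)" by (rule polyfun_one)
      show "(\<lambda>v. c) \<in> polyfun (T \<union> S)" for c by (rule polyfun.const)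
      show "p + q \<in> polyfun (T \<union> S)" "p * q \<in> polyfun (T \<union> S)"
        if "p \<in> polyfun (T \<union> S)" "q \<in> polyfun (T \<union> S)" for p q
        using that by (rule polyfun.add polyfun.mult)+
      show "- p \<in> polyfun (T \<union> S)" if "p \<in> polyfun (T \<union> S)" for p
        using that by (rule polyfun_uminus)
      show "b v = 0" if "b \<in> polyfun (T \<union> S)" "b \<in> I" for b
        using that vI by blast
    qed (fact I_zero I_add plus_fun_apply times_fun_apply refl)+
    have i: "i \<in> A - T" using insert.prems by blast
    have "P i \<in> relations"
      unfolding relations_def using P(1,2)[OF i] polyfun_mono[of _ T "T \<union> S"] by blast
    moreover have "lead_coeff (P i) v \<noteq> 0"
    proof -
      have "lead_coeff (P i) v = lead_coeff (P i) a"
        by (rule polyfun_cong[OF P(1)[OF i]]) (rule v)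
      thus ?thesis using a[OF i] by argo
    qed
    ultimately obtain t
      where t: "\<And>p. p \<in> relations \<Longrightarrow> poly (map_poly (\<lambda>p. p v) p) t = 0"
      using extend by blast
    have "p (v(i := t)) = 0" if p: "p \<in> I" "p \<in> polyfun (insert i (T \<union> S))" for p
    proof -
      obtain R where R: "\<And>j. coeff R j \<in> polyfun (T \<union> S)" "p = poly R (\<lambda>v. v i)"
        using polyfun_insert[OF p(2)] by blast
      have "coeff R j (v(i := t)) = coeff R j v" for j
        using polyfun_cong[OF R(1), of "v(i := t)" v j] TS(3) by (metis fun_upd_other)
      hence "map_poly (\<lambda>p. p (v(i := t))) R = map_poly (\<lambda>p. p v) R"
        by (intro poly_eqI) (simp add: coeff_map_poly)
      moreover have "R \<in> relations"
        using R p(1) by (simp add: relations_def)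
      ultimately show ?thesis
        using t[of R] by (simp add: R(2) poly_fun_apply)
    qed
    moreover have "\<forall>j\<in>T. (v(i := t)) j = a j"
      using v TS by auto
    ultimately show ?case
      by (metis Int_iff Un_insert_right)
  qed
  from this[of "A - T"] fin obtain v where "\<forall>p \<in> I \<inter> polyfun (T \<union> (A - T)). p v = 0"
    by auto
  moreover have "T \<union> (A - T) = A" using T by (auto simp: \<T>_def)
  ultimately show ?thesis by auto
qed

section \<open>Entire functions and their Gauss norms\<close>

lemma absv_zero [simp]: "absv (0 :: 'a::nonarch_field) = 0"
  by (simp add: absv_eq_zero_iff)

lemma absv_one [simp]: "absv (1 :: 'a::nonarch_field) = 1"
proof -
  have "absv (1 :: 'a) * absv (1 :: 'a) = absv (1 :: 'a)"
    by (metis absv_mult mult_1)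
  moreover have "absv (1 :: 'a) \<noteq> 0"
    by (simp add: absv_eq_zero_iff)
  ultimately show ?thesis by simp
qed

lemma absv_pos_iff: "absv (x :: 'a::nonarch_field) > 0 \<longleftrightarrow> x \<noteq> 0"
  using absv_nonneg[of x] absv_eq_zero_iff[of x] by linarith

lemma absv_power: "absv ((x :: 'a::nonarch_field) ^ n) = absv x ^ n"
  by (induction n) (simp_all add: absv_mult)

lemma absv_inverse: "absv (inverse (x :: 'a::nonarch_field)) = inverse (absv x)"
proof (cases "x = 0")
  case False
  hence "absv x * absv (inverse x) = 1"
    by (simp flip: absv_mult)
  thus ?thesis
    by (simp add: inverse_unique)
qed simp

lemma absv_minus [simp]: "absv (- x :: 'a::nonarch_field) = absv x"
proof -
  have "absv (- 1 :: 'a) ^ 2 = 1"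
    by (simp flip: absv_power)
  hence "absv (- 1 :: 'a) = 1"
    using absv_nonneg[of "- 1 :: 'a"] by (simp add: power2_eq_1_iff)
  moreover have "absv (- x) = absv (- 1 :: 'a) * absv x"
    using absv_mult[of "- 1" x] by simp
  ultimately show ?thesis by simp
qed

lemma absv_sum_le:
  fixes f :: "'i \<Rightarrow> 'a::nonarch_field"
  assumes "\<And>i. i \<in> S \<Longrightarrow> absv (f i) \<le> B" "0 \<le> B"
  shows "absv (sum f S) \<le> B"
  using assms
proof (induction S rule: infinite_finite_induct)
  case (insert i S)
  then show ?case
    using absv_add[of "f i" "sum f S"] by fastforce
qed auto

lemma absv_sum_less:
  fixes f :: "'i \<Rightarrow> 'a::nonarch_field"
  assumes "\<And>i. i \<in> S \<Longrightarrow> absv (f i) < B" "0 < B"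
  shows "absv (sum f S) < B"
  using assms
proof (induction S rule: infinite_finite_induct)
  case (insert i S)
  then show ?case
    using absv_add[of "f i" "sum f S"] by fastforce
qed auto

lemma absv_add_eq:
  fixes x y :: "'a::nonarch_field"
  assumes "absv y < absv x"
  shows "absv (x + y) = absv x"
  using absv_add[of x y] absv_add[of "x + y" "- y"] assms by simp

section \<open>Limits and series in the metric of \<open>absv\<close>\<close>

lemma tendsto_iff_absv:
  fixes f :: "'i \<Rightarrow> 'a::nonarch_field"
  shows "(f \<longlongrightarrow> l) F \<longleftrightarrow> ((\<lambda>x. absv (f x - l)) \<longlongrightarrow> 0) F"
  by (simp add: tendsto_dist_iff[of f] dist_absv)

lemma nonarch_tendsto_absv:
  fixes f :: "'i \<Rightarrow> 'a::nonarch_field"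
  assumes "(f \<longlongrightarrow> l) F"
  shows "((\<lambda>x. absv (f x)) \<longlongrightarrow> absv l) F"
  using tendsto_dist[OF assms tendsto_const[of 0]] by (simp add: dist_absv)

lemma nonarch_tendsto_add:
  fixes f g :: "'i \<Rightarrow> 'a::nonarch_field"
  assumes "(f \<longlongrightarrow> l) F" "(g \<longlongrightarrow> m) F"
  shows "((\<lambda>x. f x + g x) \<longlongrightarrow> l + m) F"
  unfolding tendsto_iff_absv
proof (rule tendsto_sandwich[OF _ _ tendsto_const])
  show "((\<lambda>x. max (absv (f x - l)) (absv (g x - m))) \<longlongrightarrow> 0) F"
    using tendsto_max[OF assms[unfolded tendsto_iff_absv]] by simp
  show "\<forall>\<^sub>F x in F. absv (f x + g x - (l + m)) \<le> max (absv (f x - l)) (absv (g x - m))"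
    using absv_add[of "f x - l" "g x - m" for x]
    by (intro always_eventually allI) (metis add_diff_add)
qed (simp add: absv_nonneg)

lemma nonarch_tendsto_mult:
  fixes f g :: "'i \<Rightarrow> 'a::nonarch_field"
  assumes f: "(f \<longlongrightarrow> l) F" and g: "(g \<longlongrightarrow> m) F"
  shows "((\<lambda>x. f x * g x) \<longlongrightarrow> l * m) F"
  unfolding tendsto_iff_absv
proof (rule tendsto_sandwich[OF _ _ tendsto_const])
  have "((\<lambda>x. absv (f x) * absv (g x - m) + absv (f x - l) * absv m) \<longlongrightarrow>
          absv l * 0 + 0 * absv m) F"
    by (intro tendsto_intros nonarch_tendsto_absv f g[unfolded tendsto_iff_absv]
        f[unfolded tendsto_iff_absv])
  thus "((\<lambda>x. absv (f x) * absv (g x - m) + absv (f x - l) * absv m) \<longlongrightarrow> 0) F"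
    by simp
  have "absv (f x * g x - l * m) \<le> absv (f x) * absv (g x - m) + absv (f x - l) * absv m" for x
  proof -
    have "absv (f x * g x - l * m) \<le> max (absv (f x * (g x - m))) (absv ((f x - l) * m))"
      using absv_add[of "f x * (g x - m)" "(f x - l) * m"] by (simp add: algebra_simps)
    also have "\<dots> \<le> absv (f x) * absv (g x - m) + absv (f x - l) * absv m"
      by (simp add: absv_mult absv_nonneg)
    finally show ?thesis .
  qed
  thus "\<forall>\<^sub>F x in F. absv (f x * g x - l * m) \<le>
      absv (f x) * absv (g x - m) + absv (f x - l) * absv m"
    by simp
qed (simp add: absv_nonneg)

lemma sums_terms_tendsto_zero:
  fixes a :: "nat \<Rightarrow> 'a::nonarch_field"
  assumes "a sums s"
  shows "(\<lambda>n. absv (a n)) \<longlonglongrightarrow> 0"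
proof -
  have "(\<lambda>n. dist (\<Sum>i<Suc n. a i) (\<Sum>i<n. a i)) \<longlonglongrightarrow> dist s s"
    using assms unfolding sums_def by (intro tendsto_dist LIMSEQ_Suc)
  thus ?thesis by (simp add: dist_absv)
qed

lemma nonarch_sums_add:
  fixes a b :: "nat \<Rightarrow> 'a::nonarch_field"
  assumes "a sums s" "b sums t"
  shows "(\<lambda>n. a n + b n) sums (s + t)"
  using nonarch_tendsto_add[OF assms[unfolded sums_def]] by (simp add: sums_def sum.distrib)

text \<open>Convergence of both series is enough, without absolute convergence. The product of the
  partial sums and the partial Cauchy sum differ by terms \<open>a i * b j\<close> with
  \<open>i\<close> or \<open>j\<close> large, and an ultrametric sum is bounded by its largest term,
  here a small factor times a bounded one.\<close>

lemma nonarch_Cauchy_product_sums: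
  fixes a b :: "nat \<Rightarrow> 'a::nonarch_field"
  assumes a: "a sums s" and b: "b sums t"
  shows "(\<lambda>n. \<Sum>i\<le>n. a i * b (n - i)) sums (s * t)"
proof -
  define A where "A n = (\<Sum>i<n. a i)" for n
  define B where "B n = (\<Sum>i<n. b i)" for n
  define C where "C n = (\<Sum>k<n. \<Sum>i\<le>k. a i * b (k - i))" for n
  have a0: "(\<lambda>n. absv (a n)) \<longlonglongrightarrow> 0" and b0: "(\<lambda>n. absv (b n)) \<longlonglongrightarrow> 0"
    using a b by (auto intro: sums_terms_tendsto_zero)
  obtain K where K: "K > 0" "\<And>n. absv (a n) \<le> K" "\<And>n. absv (b n) \<le> K"
  proof -
    have "Bseq (\<lambda>n. absv (a n))" "Bseq (\<lambda>n. absv (b n))"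
      using a0 b0 by (auto intro!: convergent_imp_Bseq simp: convergent_def)
    then obtain K1 K2 where "\<And>n. norm (absv (a n)) \<le> K1" "\<And>n. norm (absv (b n)) \<le> K2" "K1 > 0"
      by (meson BseqE)
    hence "0 < max K1 K2" "absv (a n) \<le> max K1 K2" "absv (b n) \<le> max K1 K2" for n
      by (auto simp: le_max_iff_disj intro: order_trans[OF abs_ge_self])
    thus ?thesis using that by blast
  qed
  have diff: "A n * B n - C n = (\<Sum>(i, j)\<in>{..<n} \<times> {..<n} - {(i, j). i + j < n}. a i * b j)" for n
  proof -
    have sub: "{(i, j). i + j < n} \<subseteq> {..<n} \<times> {..<n}" by auto
    have "A n * B n = (\<Sum>(i, j)\<in>{..<n} \<times> {..<n}. a i * b j)"
      by (simp add: A_def B_def sum_product sum.cartesian_product)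
    moreover have "C n = (\<Sum>(i, j)\<in>{(i, j). i + j < n}. a i * b j)"
      by (simp add: C_def sum.triangle_reindex)
    ultimately show ?thesis
      using sub by (simp add: sum_diff)
  qed
  have "(\<lambda>n. absv (A n * B n - C n)) \<longlonglongrightarrow> 0"
  proof (rule LIMSEQ_I)
    fix e :: real assume e: "e > 0"
    define e' where "e' = e / (2 * K)"
    have e': "e' > 0" using e K by (simp add: e'_def)
    obtain N1 N2 where N: "\<And>n. n \<ge> N1 \<Longrightarrow> absv (a n) < e'" "\<And>n. n \<ge> N2 \<Longrightarrow> absv (b n) < e'"
      using LIMSEQ_D[OF a0 e'] LIMSEQ_D[OF b0 e'] by (auto simp: absv_nonneg)
    have "absv (A n * B n - C n) < e" if n: "n \<ge> N1 + N2" for n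
    proof -
      have "absv (A n * B n - C n) \<le> e / 2"
        unfolding diff
      proof (rule absv_sum_le)
        fix p assume "p \<in> {..<n} \<times> {..<n} - {(i, j). i + j < n}"
        then obtain i j where p: "p = (i, j)" "i + j \<ge> n" by auto
        hence "i \<ge> N1 \<or> j \<ge> N2" using n by linarith
        hence "absv (a i) * absv (b j) \<le> e' * K"
        proof
          assume "i \<ge> N1"
          thus ?thesis using N K e' by (intro mult_mono) (auto simp: absv_nonneg less_imp_le)
        next
          assume "j \<ge> N2"
          hence "absv (a i) * absv (b j) \<le> K * e'"
            using N K e' by (intro mult_mono) (auto simp: absv_nonneg less_imp_le)
          thus ?thesis by (simp add: mult.commute)
        qed
        thus "absv (case p of (i, j) \<Rightarrow> a i * b j) \<le> e / 2"
          using K by (simp add: p absv_mult e'_def)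
      qed (use e in simp)
      thus ?thesis using e by simp
    qed
    thus "\<exists>no. \<forall>n\<ge>no. norm (absv (A n * B n - C n) - 0) < e"
      by (auto simp: absv_nonneg)
  qed
  hence "(\<lambda>n. C n - A n * B n) \<longlonglongrightarrow> 0"
    unfolding tendsto_iff_absv by (simp add: absv_minus[of "C _ - A _ * B _", symmetric])
  moreover have "(\<lambda>n. A n * B n) \<longlonglongrightarrow> s * t"
    using a b unfolding A_def B_def sums_def by (rule nonarch_tendsto_mult)
  ultimately have "(\<lambda>n. (C n - A n * B n) + A n * B n) \<longlonglongrightarrow> 0 + s * t"
    by (rule nonarch_tendsto_add)
  thus ?thesis by (simp add: sums_def C_def)
qed

section \<open>Ring operations on entire functions\<close>

lemma entire_sums: "entire g \<Longrightarrow> (\<lambda>j. fps_nth g j * z ^ j) sums entire_eval g z"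
  by (simp add: entire_def entire_eval_def summable_sums)

lemma entire_eval_eqI: "(\<lambda>j. fps_nth g j * z ^ j) sums s \<Longrightarrow> entire_eval g z = s"
  by (simp add: entire_eval_def sums_unique[symmetric])

lemma entire_const: "entire (fps_const c)"
  and entire_eval_const: "entire_eval (fps_const c) z = c"
proof -
  have "(\<lambda>j. fps_nth (fps_const c) j * z ^ j) sums c" for z
    using sums_finite[of "{0}" "\<lambda>j. fps_nth (fps_const c) j * z ^ j"] by simp
  thus "entire (fps_const c)" "entire_eval (fps_const c) z = c"
    by (auto simp: entire_def summable_def intro: entire_eval_eqI)
qed

lemma entire_one: "entire 1" and entire_eval_one: "entire_eval 1 z = 1"
  using entire_const[of 1] entire_eval_const[of 1] by simp_all

lemma entire_zero: "entire 0" and entire_eval_zero: "entire_eval 0 z = 0"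
  using entire_const[of 0] entire_eval_const[of 0] by simp_all

lemma
  assumes "entire g" "entire h"
  shows entire_add: "entire (g + h)"
    and entire_eval_add: "entire_eval (g + h) z = entire_eval g z + entire_eval h z"
proof -
  have "(\<lambda>j. fps_nth (g + h) j * z ^ j) sums (entire_eval g z + entire_eval h z)" for z
    using nonarch_sums_add[OF assms[THEN entire_sums]] by (simp add: algebra_simps)
  thus "entire (g + h)" "entire_eval (g + h) z = entire_eval g z + entire_eval h z"
    by (auto simp: entire_def summable_def intro: entire_eval_eqI)
qed

lemma
  assumes "entire g" "entire h"
  shows entire_mult: "entire (g * h)"
    and entire_eval_mult: "entire_eval (g * h) z = entire_eval g z * entire_eval h z"
proof -
  have "fps_nth (g * h) n * z ^ n =
      (\<Sum>i\<le>n. (fps_nth g i * z ^ i) * (fps_nth h (n - i) * z ^ (n - i)))" for n z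
    unfolding fps_mult_nth atLeast0AtMost sum_distrib_right
  proof (rule sum.cong)
    fix i assume "i \<in> {..n}"
    hence "z ^ n = z ^ i * z ^ (n - i)" by (simp flip: power_add)
    thus "fps_nth g i * fps_nth h (n - i) * z ^ n =
        (fps_nth g i * z ^ i) * (fps_nth h (n - i) * z ^ (n - i))"
      by (simp add: mult_ac)
  qed simp
  hence "(\<lambda>j. fps_nth (g * h) j * z ^ j) sums (entire_eval g z * entire_eval h z)" for z
    using nonarch_Cauchy_product_sums[OF assms[THEN entire_sums]] by simp
  thus "entire (g * h)" "entire_eval (g * h) z = entire_eval g z * entire_eval h z"
    by (auto simp: entire_def summable_def intro: entire_eval_eqI)
qed

lemma
  assumes "entire g"
  shows entire_power: "entire (g ^ n)"
    and entire_eval_power: "entire_eval (g ^ n) z = entire_eval g z ^ n"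
  by (induction n)
     (simp_all add: entire_one entire_eval_one entire_mult entire_eval_mult assms)

lemma
  assumes "\<And>i. i \<in> S \<Longrightarrow> entire (g i)"
  shows entire_sum: "entire (sum g S)"
    and entire_eval_sum: "entire_eval (sum g S) z = (\<Sum>i\<in>S. entire_eval (g i) z)"
proof -
  have "entire (sum g S) \<and> entire_eval (sum g S) z = (\<Sum>i\<in>S. entire_eval (g i) z)"
    using assms
    by (induction S rule: infinite_finite_induct)
       (simp_all add: entire_zero entire_eval_zero entire_add entire_eval_add)
  thus "entire (sum g S)" "entire_eval (sum g S) z = (\<Sum>i\<in>S. entire_eval (g i) z)"
    by auto
qed

lemma
  assumes "\<And>i. i \<in> S \<Longrightarrow> entire (g i)"
  shows entire_prod: "entire (prod g S)"
    and entire_eval_prod: "entire_eval (prod g S) z = (\<Prod>i\<in>S. entire_eval (g i) z)"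
proof -
  have "entire (prod g S) \<and> entire_eval (prod g S) z = (\<Prod>i\<in>S. entire_eval (g i) z)"
    using assms
    by (induction S rule: infinite_finite_induct)
       (simp_all add: entire_one entire_eval_one entire_mult entire_eval_mult)
  thus "entire (prod g S)" "entire_eval (prod g S) z = (\<Prod>i\<in>S. entire_eval (g i) z)"
    by auto
qed

section \<open>Trivial and unbounded absolute values\<close>

text \<open>Powers of an element with absolute value above 1 are unbounded. If there is no such
  element, the bound applied to inverses forces the value 1.\<close>

lemma absv_trivial_or_unbounded:
  "(\<forall>x::'a::nonarch_field. x \<noteq> 0 \<longrightarrow> absv x = 1) \<or> (\<forall>r. \<exists>x::'a. absv x > r)"
proof (rule disjCI)
  assume "\<not> (\<forall>r. \<exists>x::'a. absv x > r)"
  then obtain r where r: "\<And>x::'a. absv x \<le> r" by (auto simp: not_less)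
  have le: "absv x \<le> 1" for x :: 'a
  proof (rule ccontr)
    assume "\<not> absv x \<le> 1"
    then obtain n where "absv x ^ n > r"
      using real_arch_pow[of "absv x" r] by auto
    with r[of "x ^ n"] show False by (simp add: absv_power)
  qed
  show "\<forall>x::'a. x \<noteq> 0 \<longrightarrow> absv x = 1"
  proof (intro allI impI)
    fix x :: 'a assume "x \<noteq> 0"
    hence "absv x > 0" by (simp add: absv_pos_iff)
    moreover have "inverse (absv x) \<le> 1"
      using le[of "inverse x"] by (simp add: absv_inverse)
    ultimately have "absv x \<ge> 1"
      by (simp add: field_simps)
    with le[of x] show "absv x = 1" by simp
  qed
qed

lemma entire_trivial_absv:
  fixes g :: "'a::nonarch_field fps"
  assumes "entire g" and triv: "\<forall>x::'a. x \<noteq> 0 \<longrightarrow> absv x = 1"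
  shows "\<exists>n. \<forall>j\<ge>n. fps_nth g j = 0"
proof -
  have "(\<lambda>j. absv (fps_nth g j)) \<longlonglongrightarrow> 0"
    using sums_terms_tendsto_zero[OF entire_sums[OF assms(1), of 1]] by simp
  hence "\<forall>\<^sub>F j in sequentially. absv (fps_nth g j) < 1"
    by (rule order_tendstoD) simp
  thus ?thesis
    using triv by (auto simp: eventually_sequentially) (metis less_irrefl)
qed

text \<open>Convergence is given at elements of the field only, and \<open>r\<close> need not be an
  absolute value; an element of larger absolute value dominates. This makes the supremum in
  \<open>gauss_norm\<close> finite and, for positive radii, attained.\<close>

lemma entire_coeff_tendsto:
  fixes g :: "'a::nonarch_field fps"
  assumes g: "entire g" and r: "r \<ge> 0"
  shows "(\<lambda>j. absv (fps_nth g j) * r ^ j) \<longlonglongrightarrow> 0"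
  using absv_trivial_or_unbounded[where 'a = 'a]
proof
  assume "\<forall>x::'a. x \<noteq> 0 \<longrightarrow> absv x = 1"
  then obtain n where "\<forall>j\<ge>n. fps_nth g j = 0"
    using entire_trivial_absv g by blast
  thus ?thesis
    by (intro tendsto_eventually) (auto simp: eventually_sequentially absv_eq_zero_iff)
next
  assume "\<forall>r. \<exists>x::'a. absv x > r"
  then obtain x :: 'a where x: "absv x > r" by blast
  show ?thesis
  proof (rule tendsto_sandwich[OF _ _ tendsto_const])
    show "(\<lambda>j. absv (fps_nth g j * x ^ j)) \<longlonglongrightarrow> 0"
      using sums_terms_tendsto_zero[OF entire_sums[OF g, of x]] .
    show "\<forall>\<^sub>F j in sequentially. absv (fps_nth g j) * r ^ j \<le> absv (fps_nth g j * x ^ j)"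
      using x r by (intro always_eventually allI)
        (auto simp: absv_mult absv_power absv_nonneg intro!: mult_left_mono power_mono)
  qed (use r in \<open>simp add: absv_nonneg\<close>)
qed

section \<open>Gauss norms and their multiplicativity\<close>

lemma gauss_norm_ge:
  assumes "entire g" "r \<ge> 0"
  shows "absv (fps_nth g j) * r ^ j \<le> gauss_norm g r"
  unfolding gauss_norm_def
proof (rule cSUP_upper)
  have "Bseq (\<lambda>j. absv (fps_nth g j) * r ^ j)"
    using entire_coeff_tendsto[OF assms] by (auto intro!: convergent_imp_Bseq simp: convergent_def)
  thus "bdd_above (range (\<lambda>j. absv (fps_nth g j) * r ^ j))"
    by (rule Bseq_bdd_above)
qed simp

lemma gauss_norm_le:
  "(\<And>j. absv (fps_nth g j) * r ^ j \<le> B) \<Longrightarrow> gauss_norm g r \<le> B"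
  unfolding gauss_norm_def by (rule cSUP_least) auto

lemma gauss_norm_nonneg: "entire g \<Longrightarrow> r \<ge> 0 \<Longrightarrow> gauss_norm g r \<ge> 0"
  using gauss_norm_ge[of g r 0] absv_nonneg[of "fps_nth g 0"] by simp

lemma gauss_norm_const_le: "r \<ge> 0 \<Longrightarrow> gauss_norm (fps_const c) r \<le> absv c"
  by (rule gauss_norm_le) (simp add: absv_nonneg)

lemma gauss_norm_zero_le: "gauss_norm 0 r \<le> 0"
  by (rule gauss_norm_le) simp

lemma gauss_norm_pos:
  assumes "entire g" "r > 0" "g \<noteq> 0"
  shows "gauss_norm g r > 0"
proof -
  obtain j where "fps_nth g j \<noteq> 0" using assms(3) by (auto simp: fps_eq_iff)
  hence "0 < absv (fps_nth g j) * r ^ j" using assms by (simp add: absv_pos_iff)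
  thus ?thesis using gauss_norm_ge[of g r j] assms by simp
qed

lemma gauss_norm_add_le:
  assumes "entire g" "entire h" "r \<ge> 0"
  shows "gauss_norm (g + h) r \<le> max (gauss_norm g r) (gauss_norm h r)"
proof (rule gauss_norm_le)
  fix j
  have "absv (fps_nth (g + h) j) * r ^ j \<le>
      max (absv (fps_nth g j)) (absv (fps_nth h j)) * r ^ j"
    using absv_add assms by (intro mult_right_mono) auto
  also have "\<dots> = max (absv (fps_nth g j) * r ^ j) (absv (fps_nth h j) * r ^ j)"
    using assms by (simp add: max_mult_distrib_right)
  also have "\<dots> \<le> max (gauss_norm g r) (gauss_norm h r)"
    using assms by (intro max.mono gauss_norm_ge)
  finally show "absv (fps_nth (g + h) j) * r ^ j \<le> \<dots>" .
qed

lemma gauss_norm_sum_le: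
  assumes "\<And>i. i \<in> S \<Longrightarrow> entire (g i)" "\<And>i. i \<in> S \<Longrightarrow> gauss_norm (g i) r \<le> B"
    and "r \<ge> 0" "B \<ge> 0"
  shows "gauss_norm (sum g S) r \<le> B"
  using assms
proof (induction S rule: infinite_finite_induct)
  case (insert i S)
  then show ?case
    using gauss_norm_add_le[of "g i" "sum g S" r] entire_sum[of S g] by fastforce
qed (auto intro: order_trans[OF gauss_norm_zero_le])

lemma gauss_norm_mult_le:
  assumes "entire g" "entire h" "r \<ge> 0"
  shows "gauss_norm (g * h) r \<le> gauss_norm g r * gauss_norm h r"
proof (rule gauss_norm_le)
  fix n
  have summand: "absv (fps_nth g i * fps_nth h (n - i)) * r ^ n \<le>
      gauss_norm g r * gauss_norm h r" if "i \<le> n" for i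
  proof -
    have "absv (fps_nth g i * fps_nth h (n - i)) * r ^ n =
        (absv (fps_nth g i) * r ^ i) * (absv (fps_nth h (n - i)) * r ^ (n - i))"
      using power_add[of r i "n - i"] that by (simp add: absv_mult)
    also have "\<dots> \<le> gauss_norm g r * gauss_norm h r"
      using assms by (intro mult_mono gauss_norm_ge gauss_norm_nonneg) (auto simp: absv_nonneg)
    finally show ?thesis by simp
  qed
  show "absv (fps_nth (g * h) n) * r ^ n \<le> gauss_norm g r * gauss_norm h r"
  proof (cases "r ^ n = 0")
    case True
    show ?thesis unfolding True using assms by (simp add: gauss_norm_nonneg)
  next
    case False
    hence pos: "r ^ n > 0" using zero_le_power[OF assms(3), of n] by linarith
    have "absv (fps_nth (g * h) n) \<le> gauss_norm g r * gauss_norm h r / r ^ n"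
      unfolding fps_mult_nth using summand pos assms
      by (intro absv_sum_le) (auto simp: pos_le_divide_eq gauss_norm_nonneg)
    thus ?thesis using pos by (simp add: pos_le_divide_eq)
  qed
qed

text \<open>The terms tend to 0, so the supremum is a maximum over a finite range of indices. The
  least maximising index is singled out for the proof of multiplicativity.\<close>

lemma gauss_norm_first_index:
  assumes "entire g" "r > 0" "g \<noteq> 0"
  obtains k where "absv (fps_nth g k) * r ^ k = gauss_norm g r"
    "\<And>i. i < k \<Longrightarrow> absv (fps_nth g i) * r ^ i < gauss_norm g r"
proof -
  define u where "u j = absv (fps_nth g j) * r ^ j" for j
  obtain j0 where "fps_nth g j0 \<noteq> 0" using assms(3) by (auto simp: fps_eq_iff)
  hence pos: "0 < u j0" using assms by (simp add: u_def absv_pos_iff)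
  have "u \<longlonglongrightarrow> 0"
    unfolding u_def using assms by (intro entire_coeff_tendsto) auto
  hence "\<forall>\<^sub>F j in sequentially. u j < u j0"
    using pos by (rule order_tendstoD)
  then obtain n where n: "\<And>j. j \<ge> n \<Longrightarrow> u j < u j0"
    by (auto simp: eventually_sequentially)
  have "j0 < n" using n[of j0] by (meson less_irrefl not_le)
  obtain m where m: "m < n" "\<And>j. j < n \<Longrightarrow> u j \<le> u m"
  proof -
    have "Max (u ` {..<n}) \<in> u ` {..<n}"
      using \<open>j0 < n\<close> by (intro Max_in) auto
    then obtain m where "m < n" "u m = Max (u ` {..<n})" by auto
    thus ?thesis using that by simp
  qed
  have "u j \<le> u m" for j
    using m n \<open>j0 < n\<close> by (meson leI less_imp_le order_trans)
  hence "gauss_norm g r \<le> u m"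
    unfolding u_def by (rule gauss_norm_le)
  hence "u m = gauss_norm g r"
    using gauss_norm_ge[of g r m] assms by (simp add: u_def)
  hence L: "u (LEAST k. u k = gauss_norm g r) = gauss_norm g r"
    by (rule LeastI)
  show ?thesis
  proof (rule that)
    show "absv (fps_nth g i) * r ^ i < gauss_norm g r" if "i < (LEAST k. u k = gauss_norm g r)" for i
      using not_less_Least[OF that] gauss_norm_ge[of g r i] assms by (simp add: u_def)
  qed (use L in \<open>simp add: u_def\<close>)
qed

text \<open>As in Gauss's lemma, the coefficient of index \<open>i0 + j0\<close> decides: any other
  product in it has a factor of index below \<open>i0\<close> or below \<open>j0\<close>, whose term
  is strictly below the maximum, so the main term determines the absolute value of the sum. Equality
  is needed later to evaluate the Gauss norm of powers of \<open>F k\<close>.\<close>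

lemma gauss_norm_mult:
  assumes g: "entire g" and h: "entire h" and r: "r > 0"
  shows "gauss_norm (g * h) r = gauss_norm g r * gauss_norm h r"
proof (cases "g = 0 \<or> h = 0")
  case True
  have "gauss_norm (0 :: 'a fps) r = 0"
    using gauss_norm_zero_le[of r] gauss_norm_nonneg[OF entire_zero, of r] r
    by (meson antisym less_imp_le)
  with True show ?thesis by auto
next
  case False
  obtain i0 where i0: "absv (fps_nth g i0) * r ^ i0 = gauss_norm g r"
    "\<And>i. i < i0 \<Longrightarrow> absv (fps_nth g i) * r ^ i < gauss_norm g r"
    using gauss_norm_first_index[OF g r] False by blast
  obtain j0 where j0: "absv (fps_nth h j0) * r ^ j0 = gauss_norm h r"
    "\<And>j. j < j0 \<Longrightarrow> absv (fps_nth h j) * r ^ j < gauss_norm h r"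
    using gauss_norm_first_index[OF h r] False by blast
  have pos: "gauss_norm g r > 0" "gauss_norm h r > 0"
    using False g h r by (auto intro: gauss_norm_pos)
  define n where "n = i0 + j0"
  define M where "M = gauss_norm g r * gauss_norm h r"
  have split: "absv (fps_nth g i * fps_nth h (n - i)) * r ^ n =
      (absv (fps_nth g i) * r ^ i) * (absv (fps_nth h (n - i)) * r ^ (n - i))" if "i \<le> n" for i
    using power_add[of r i "n - i"] that by (simp add: absv_mult)
  have mult_less: "a * b < a' * b'" if "0 \<le> a" "a < a'" "b \<le> b'" "0 < b'" for a a' b b' :: real
    using that by (meson le_less_trans mult_left_mono mult_strict_right_mono)
  have "absv (fps_nth g i * fps_nth h (n - i)) * r ^ n < M" if "i \<in> {0..n} - {i0}" for i
  proof (cases "i < i0")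
    case True
    then show ?thesis
      unfolding M_def using that r i0(2)[OF True] gauss_norm_ge[OF h, of r "n - i"] pos
      by (subst split) (auto intro!: mult_less simp: absv_nonneg)
  next
    case False
    hence less: "n - i < j0" using that by (auto simp: n_def)
    show ?thesis
      unfolding M_def mult.commute[of "gauss_norm g r"]
      using that r j0(2)[OF less] gauss_norm_ge[OF g, of r i] pos
      by (subst split, simp, subst mult.commute) (auto intro!: mult_less simp: absv_nonneg)
  qed
  hence rest: "absv (\<Sum>i\<in>{0..n} - {i0}. fps_nth g i * fps_nth h (n - i)) < M / r ^ n"
    using r pos by (intro absv_sum_less) (auto simp: pos_less_divide_eq M_def)
  have main: "absv (fps_nth g i0 * fps_nth h j0) = M / r ^ n"
    using split[of i0] r unfolding M_def i0(1)[symmetric] j0(1)[symmetric]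
    by (simp add: n_def eq_divide_eq)
  have "fps_nth (g * h) n = fps_nth g i0 * fps_nth h j0 +
      (\<Sum>i\<in>{0..n} - {i0}. fps_nth g i * fps_nth h (n - i))"
    unfolding fps_mult_nth by (subst sum.remove[of _ i0]) (auto simp: n_def)
  hence "absv (fps_nth (g * h) n) * r ^ n = M"
    using absv_add_eq[of _ "fps_nth g i0 * fps_nth h j0"] rest main r by simp
  hence "M \<le> gauss_norm (g * h) r"
    using gauss_norm_ge[of "g * h" r n] g h r by (simp add: entire_mult)
  thus ?thesis
    using gauss_norm_mult_le[of g h r] g h r by (simp add: M_def)
qed

lemma gauss_norm_one: "gauss_norm 1 r = 1" if "r > 0"
proof -
  have "gauss_norm 1 r \<le> 1"
    using gauss_norm_const_le[of r 1] that by simp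
  moreover have "1 \<le> gauss_norm 1 r"
    using gauss_norm_ge[OF entire_one, of r 0] that by simp
  ultimately show ?thesis by (rule antisym)
qed

lemma gauss_norm_power:
  assumes "entire g" "r > 0"
  shows "gauss_norm (g ^ n) r = gauss_norm g r ^ n"
  using assms by (induction n) (simp_all add: gauss_norm_one gauss_norm_mult entire_power)

text \<open>
  For the trivial absolute value entire functions are polynomials.  Otherwise, near \<open>0\<close>, the
  lowest nonzero term dominates.
\<close>

lemma entire_eq_zero:
  fixes g :: "'a::nonarch_field fps"
  assumes g: "entire g" and inf: "infinite (UNIV :: 'a set)"
    and zero: "\<And>z. entire_eval g z = 0"
  shows "g = 0"
  using absv_trivial_or_unbounded[where 'a = 'a]
proof
  assume "\<forall>x::'a. x \<noteq> 0 \<longrightarrow> absv x = 1"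
  then obtain n where n: "\<And>j. j \<ge> n \<Longrightarrow> fps_nth g j = 0"
    using entire_trivial_absv g by blast
  define P where "P = (\<Sum>j<n. monom (fps_nth g j) j)"
  have "poly P z = entire_eval g z" for z
    unfolding P_def using n
    by (subst entire_eval_eqI[OF sums_finite[of "{..<n}"]]) (auto simp: poly_sum poly_monom)
  hence "P = 0"
    using zero poly_roots_finite[of P] inf by auto
  show "g = 0"
  proof (rule fps_ext)
    fix j
    have "coeff P j = (if j < n then fps_nth g j else 0)"
      by (simp add: P_def coeff_sum)
    thus "fps_nth g j = fps_nth 0 j"
      using \<open>P = 0\<close> n[of j] by (cases "j < n") auto
  qed
next
  assume unb: "\<forall>r. \<exists>x::'a. absv x > r"
  show "g = 0"
  proof (rule ccontr)
    assume "g \<noteq> 0"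
    define k where "k = subdegree g"
    define c where "c = absv (fps_nth g k)"
    define B where "B = gauss_norm g 1"
    have c: "c > 0" using \<open>g \<noteq> 0\<close> by (simp add: c_def k_def absv_pos_iff)
    have B: "absv (fps_nth g j) \<le> B" for j
      using gauss_norm_ge[OF g, of 1 j] by (simp add: B_def)
    hence "B > 0" using c by (metis c_def less_le_trans)
    \<comment> \<open>Small elements are inverses of large ones. The bound \<open>B / c\<close>
      gives \<open>B * absv z < c\<close>, which together with \<open>absv z < 1\<close> lets the
      term of index \<open>k\<close> exceed all later ones; the partial sums then cannot tend to
      0.\<close>
    obtain x :: 'a where x: "absv x > max 1 (B / c)" using unb by blast
    define z where "z = inverse x"
    have z: "0 < absv z" "absv z < 1" "B * absv z < c"
      unfolding z_def absv_inverse using x c \<open>B > 0\<close> by (auto simp: field_simps)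
    have low: "absv (\<Sum>j<Suc k + n. fps_nth g j * z ^ j) = c * absv z ^ k" for n
    proof -
      have "(\<Sum>j<Suc k + n. fps_nth g j * z ^ j) =
          (\<Sum>j\<in>{..<Suc k + n} - {k}. fps_nth g j * z ^ j) + fps_nth g k * z ^ k"
        by (subst sum.remove[of _ k]) auto
      also have "\<dots> = fps_nth g k * z ^ k + (\<Sum>j\<in>{..<Suc k + n} - {k}. fps_nth g j * z ^ j)"
        by (rule add.commute)
      finally have eq: "(\<Sum>j<Suc k + n. fps_nth g j * z ^ j) = \<dots>" .
      have "absv (fps_nth g j * z ^ j) < c * absv z ^ k" if "j \<noteq> k" for j
      proof (cases "j < k")
        case True
        hence "fps_nth g j = 0" unfolding k_def by (rule nth_less_subdegree_zero)
        thus ?thesis using c z by simp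
      next
        case False
        hence "absv z ^ j \<le> absv z ^ Suc k"
          using z that by (intro power_decreasing) auto
        hence "absv (fps_nth g j * z ^ j) \<le> B * absv z ^ Suc k"
          using B[of j] \<open>B > 0\<close> z by (auto simp: absv_mult absv_power absv_nonneg intro!: mult_mono)
        also have "\<dots> = (B * absv z) * absv z ^ k" by simp
        also have "\<dots> < c * absv z ^ k"
          using z by (intro mult_strict_right_mono) auto
        finally show ?thesis .
      qed
      hence "absv (\<Sum>j\<in>{..<Suc k + n} - {k}. fps_nth g j * z ^ j) < c * absv z ^ k"
        using c z by (intro absv_sum_less) auto
      thus ?thesis
        unfolding eq by (subst absv_add_eq) (simp_all add: absv_mult absv_power c_def)
    qed
    have "(\<lambda>n. \<Sum>j<n. fps_nth g j * z ^ j) \<longlonglongrightarrow> 0"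
      using entire_sums[OF g, of z] zero by (simp add: sums_def)
    hence "(\<lambda>n. \<Sum>j<n + Suc k. fps_nth g j * z ^ j) \<longlonglongrightarrow> 0"
      by (rule LIMSEQ_ignore_initial_segment)
    from nonarch_tendsto_absv[OF this] have "(\<lambda>n. c * absv z ^ k) \<longlonglongrightarrow> 0"
      using low by (simp only: add.commute[of _ "Suc k"] absv_zero)
    hence "c * absv z ^ k = 0" by (simp add: LIMSEQ_const_iff)
    with c z show False by simp
  qed
qed

lemma entire_eqI:
  fixes g h :: "'a::nonarch_field fps"
  assumes "entire g" "entire h" and inf: "infinite (UNIV :: 'a set)"
    and eq: "\<And>z. entire_eval g z = entire_eval h z"
  shows "g = h"
proof -
  have "entire (fps_const (- 1) * h)"
    using assms by (intro entire_mult entire_const)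
  hence "g + fps_const (- 1) * h = 0"
    using assms by (intro entire_eq_zero)
      (simp_all add: entire_add entire_eval_add entire_eval_mult entire_const entire_eval_const)
  thus ?thesis
    by (simp add: fps_eq_iff)
qed

section \<open>Forms\<close>

lemma polyfun_sum_apply:
  assumes "\<And>i. i \<in> S \<Longrightarrow> f i \<in> polyfun A"
  shows "(\<lambda>v. \<Sum>i\<in>S. f i v) \<in> polyfun A"
proof -
  have "(\<lambda>v. \<Sum>i\<in>S. f i v) = sum f S"
    by (induction S rule: infinite_finite_induct) (auto simp: fun_eq_iff)
  thus ?thesis using polyfun_sum[of S f A] assms by simp
qed

lemma polyfun_prod_apply:
  assumes "\<And>i. i \<in> S \<Longrightarrow> f i \<in> polyfun A"
  shows "(\<lambda>v. \<Prod>i\<in>S. f i v) \<in> polyfun A"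
proof -
  have "(\<lambda>v. \<Prod>i\<in>S. f i v) = prod f S"
    by (induction S rule: infinite_finite_induct) (auto simp: fun_eq_iff)
  thus ?thesis using polyfun_prod[of S f A] assms by simp
qed

lemma polyfun_mult_apply:
  assumes "p \<in> polyfun A" "q \<in> polyfun A"
  shows "(\<lambda>v. p v * q v) \<in> polyfun A"
  using polyfun.mult[OF assms] by (simp add: times_fun_def)

lemma polyfun_power_apply:
  assumes "p \<in> polyfun A"
  shows "(\<lambda>v. p v ^ n) \<in> polyfun A"
proof (induction n)
  case 0
  show ?case using polyfun.const[of 1 A] by simp
next
  case (Suc n)
  show ?case using polyfun_mult_apply[OF assms Suc] by simp
qed

lemma mpoly_eval_polyfun:
  assumes "is_form N d Q"
  shows "(\<lambda>v. mpoly_eval v Q) \<in> polyfun {..N}"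
  unfolding mpoly_subst_def
  by (intro polyfun_sum_apply polyfun_mult_apply polyfun_prod_apply polyfun_power_apply
      polyfun.const polyfun.var) (use assms in \<open>auto simp: is_form_def\<close>)

lemma mpoly_eval_scale:
  assumes "is_form N d Q"
  shows "mpoly_eval (\<lambda>i. c * v i) Q = c ^ d * mpoly_eval v Q"
  unfolding mpoly_subst_def sum_distrib_left
proof (rule sum.cong)
  fix m assume "m \<in> Poly_Mapping.keys Q"
  hence "(\<Sum>i\<in>Poly_Mapping.keys m. Poly_Mapping.lookup m i) = d"
    using assms by (auto simp: is_form_def)
  hence "c ^ d = (\<Prod>i\<in>Poly_Mapping.keys m. c ^ Poly_Mapping.lookup m i)"
    by (simp flip: power_sum)
  thus "Poly_Mapping.lookup Q m *
        (\<Prod>i\<in>Poly_Mapping.keys m. (c * v i) ^ Poly_Mapping.lookup m i) =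
      c ^ d * (Poly_Mapping.lookup Q m *
        (\<Prod>i\<in>Poly_Mapping.keys m. v i ^ Poly_Mapping.lookup m i))"
    by (simp add: power_mult_distrib prod.distrib mult_ac)
qed simp

lemma proj_point_in_zero_locus:
  assumes v: "v \<in> nonzero_vecs N" and forms: "\<And>P. P \<in> S \<Longrightarrow> \<exists>d. is_form N d P"
    and zero: "\<And>P. P \<in> S \<Longrightarrow> mpoly_eval v P = 0"
  shows "proj_point N v \<in> zero_locus N S"
  unfolding zero_locus_def
proof (intro CollectI conjI ballI)
  show "proj_point N v \<in> proj_space N"
    unfolding proj_point_def proj_space_def using v by (rule quotientI)
  fix P assume P: "P \<in> S"
  then obtain d where d: "is_form N d P" using forms by blast
  show "vanishes_at P (proj_point N v)"
    using mpoly_eval_scale[OF d] zero[OF P]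
    by (auto simp: vanishes_at_def proj_point_def proportional_def)
qed

lemma zero_locus_proj_pointD:
  assumes v: "v \<in> nonzero_vecs N" and "proj_point N v \<in> zero_locus N S" "P \<in> S"
  shows "mpoly_eval v P = 0"
proof -
  have "v \<in> proj_point N v"
    using v by (auto simp: proj_point_def proportional_def intro!: exI[of _ 1])
  thus ?thesis
    using assms by (auto simp: zero_locus_def vanishes_at_def)
qed

section \<open>Analytic curves\<close>

locale analytic_curve =
  fixes N :: nat and F :: "nat \<Rightarrow> 'k::{alg_closed_field, nonarch_field} fps"
  assumes entire: "\<And>i. i \<le> N \<Longrightarrow> entire (F i)"
    and no_common_zero: "\<And>z. \<exists>i\<le>N. entire_eval (F i) z \<noteq> 0"
begin

definition point :: "'k \<Rightarrow> nat \<Rightarrow> 'k" where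
  "point z = (\<lambda>i. if i \<le> N then entire_eval (F i) z else 0)"

lemma point_nonzero: "point z \<in> nonzero_vecs N"
  using no_common_zero[of z] by (auto simp: nonzero_vecs_def point_def)

abbreviation nrm :: "real \<Rightarrow> real" where
  "nrm \<equiv> curve_norm N F"

lemma gauss_norm_le_nrm: "i \<le> N \<Longrightarrow> gauss_norm (F i) r \<le> nrm r"
  unfolding curve_norm_def by (intro Max_ge) auto

lemma nrm_attained: "\<exists>k\<le>N. gauss_norm (F k) r = nrm r"
proof -
  have "nrm r \<in> (\<lambda>i. gauss_norm (F i) r) ` {..N}"
    unfolding curve_norm_def by (intro Max_in) auto
  thus ?thesis by auto
qed

lemma nrm_pos: assumes "r > 0" shows "nrm r > 0"
proof -
  obtain i where i: "i \<le> N" "entire_eval (F i) 0 \<noteq> 0" using no_common_zero by blast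
  hence "F i \<noteq> 0" by (auto simp: entire_eval_zero)
  hence "gauss_norm (F i) r > 0" using entire i assms by (intro gauss_norm_pos)
  thus ?thesis using gauss_norm_le_nrm[OF i(1), of r] by simp
qed

section \<open>Growth along the curve\<close>

text \<open>\<open>M\<close> acts as a weight, like the degree of a form in the components of the
  curve: weights add under products, and sums require equal weights. The constant \<open>C\<close>
  must serve all radii at once.\<close>

definition dominated :: "nat \<Rightarrow> 'k fps \<Rightarrow> bool" where
  "dominated M G \<longleftrightarrow> entire G \<and> (\<exists>C\<ge>0. \<forall>r>0. gauss_norm G r \<le> C * nrm r ^ M)"

lemma dominated_entire: "dominated M G \<Longrightarrow> entire G"
  by (simp add: dominated_def)

lemma dominated_const: "dominated 0 (fps_const c)"
  using gauss_norm_const_le[of _ c]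
  by (auto simp: dominated_def entire_const absv_nonneg intro!: exI[of _ "absv c"])

lemma dominated_zero: "dominated M 0"
  by (auto simp: dominated_def entire_zero intro!: exI[of _ 0] gauss_norm_zero_le)

lemma dominated_component: "i \<le> N \<Longrightarrow> dominated 1 (F i)"
  by (auto simp: dominated_def entire gauss_norm_le_nrm intro!: exI[of _ 1])

lemma dominated_add:
  assumes "dominated M G" "dominated M H"
  shows "dominated M (G + H)"
proof -
  from assms obtain C D where C: "C \<ge> 0" "\<forall>r>0. gauss_norm G r \<le> C * nrm r ^ M"
    and D: "D \<ge> 0" "\<forall>r>0. gauss_norm H r \<le> D * nrm r ^ M"
    by (auto simp: dominated_def)
  have "gauss_norm (G + H) r \<le> max C D * nrm r ^ M" if r: "r > 0" for r
  proof -
    have "gauss_norm (G + H) r \<le> max (gauss_norm G r) (gauss_norm H r)"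
      using assms r by (intro gauss_norm_add_le) (auto simp: dominated_def)
    also have "\<dots> \<le> max (C * nrm r ^ M) (D * nrm r ^ M)"
      using C D r by (intro max.mono) auto
    also have "\<dots> = max C D * nrm r ^ M"
      using nrm_pos[OF r] by (simp add: max_mult_distrib_right)
    finally show ?thesis .
  qed
  thus ?thesis
    using assms C by (auto simp: dominated_def entire_add intro!: exI[of _ "max C D"])
qed

lemma dominated_mult:
  assumes "dominated M G" "dominated M' H"
  shows "dominated (M + M') (G * H)"
proof -
  from assms obtain C D where C: "C \<ge> 0" "\<forall>r>0. gauss_norm G r \<le> C * nrm r ^ M"
    and D: "D \<ge> 0" "\<forall>r>0. gauss_norm H r \<le> D * nrm r ^ M'"
    by (auto simp: dominated_def)
  have "gauss_norm (G * H) r \<le> (C * D) * nrm r ^ (M + M')" if r: "r > 0" for r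
  proof -
    have "gauss_norm (G * H) r \<le> gauss_norm G r * gauss_norm H r"
      using assms r by (intro gauss_norm_mult_le) (auto simp: dominated_def)
    also have "\<dots> \<le> (C * nrm r ^ M) * (D * nrm r ^ M')"
      using C D r nrm_pos[OF r] assms
      by (intro mult_mono gauss_norm_nonneg mult_nonneg_nonneg) (auto simp: dominated_def)
    finally show ?thesis by (simp add: power_add mult_ac)
  qed
  thus ?thesis
    using assms C D by (auto simp: dominated_def entire_mult intro!: exI[of _ "C * D"])
qed

lemma dominated_power: "dominated M G \<Longrightarrow> dominated (n * M) (G ^ n)"
  by (induction n) (auto simp: dominated_mult dominated_const[of 1, simplified])

lemma dominated_component_power: "i \<le> N \<Longrightarrow> dominated n (F i ^ n)"
  using dominated_power[OF dominated_component, of i n] by simp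

lemma dominated_sum: "(\<And>i. i \<in> S \<Longrightarrow> dominated M (G i)) \<Longrightarrow> dominated M (sum G S)"
  by (induction S rule: infinite_finite_induct) (auto simp: dominated_zero dominated_add)

lemma dominated_prod:
  "(\<And>i. i \<in> S \<Longrightarrow> dominated (e i) (G i)) \<Longrightarrow> dominated (sum e S) (prod G S)"
  by (induction S rule: infinite_finite_induct)
     (auto simp: dominated_mult dominated_const[of 1, simplified])

lemma dominated_form_compose:
  assumes "is_form N d Q"
  shows "dominated d (form_compose Q F)"
  unfolding form_compose_def mpoly_subst_def
proof (rule dominated_sum)
  fix m assume m: "m \<in> Poly_Mapping.keys Q"
  have "dominated (0 + (\<Sum>i\<in>Poly_Mapping.keys m. Poly_Mapping.lookup m i))
     (fps_const (Poly_Mapping.lookup Q m) *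
        (\<Prod>i\<in>Poly_Mapping.keys m. F i ^ Poly_Mapping.lookup m i))"
    using assms m
    by (intro dominated_mult dominated_const dominated_prod dominated_component_power)
       (auto simp: is_form_def)
  thus "dominated d (fps_const (Poly_Mapping.lookup Q m) *
        (\<Prod>i\<in>Poly_Mapping.keys m. F i ^ Poly_Mapping.lookup m i))"
    using assms m by (auto simp: is_form_def)
qed

lemma entire_form_compose: "is_form N d Q \<Longrightarrow> entire (form_compose Q F)"
  using dominated_form_compose dominated_entire by blast

lemma entire_eval_form_compose:
  assumes "is_form N d Q"
  shows "entire_eval (form_compose Q F) z = mpoly_eval (point z) Q"
proof -
  have le: "i \<le> N" if "m \<in> Poly_Mapping.keys Q" "i \<in> Poly_Mapping.keys m" for m i
    using assms that by (auto simp: is_form_def)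
  have "entire_eval (form_compose Q F) z = (\<Sum>m\<in>Poly_Mapping.keys Q.
     entire_eval (fps_const (Poly_Mapping.lookup Q m) *
        (\<Prod>i\<in>Poly_Mapping.keys m. F i ^ Poly_Mapping.lookup m i)) z)"
    unfolding form_compose_def mpoly_subst_def
    by (intro entire_eval_sum entire_mult entire_const entire_prod entire_power entire le)
  also have "\<dots> = mpoly_eval (point z) Q"
    unfolding mpoly_subst_def
  proof (rule sum.cong)
    fix m assume m: "m \<in> Poly_Mapping.keys Q"
    have "entire_eval (\<Prod>i\<in>Poly_Mapping.keys m. F i ^ Poly_Mapping.lookup m i) z =
        (\<Prod>i\<in>Poly_Mapping.keys m. point z i ^ Poly_Mapping.lookup m i)"
      using le[OF m]
      by (subst entire_eval_prod) (auto simp: entire_power entire entire_eval_power point_def)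
    thus "entire_eval (fps_const (Poly_Mapping.lookup Q m) *
        (\<Prod>i\<in>Poly_Mapping.keys m. F i ^ Poly_Mapping.lookup m i)) z =
      Poly_Mapping.lookup Q m * (\<Prod>i\<in>Poly_Mapping.keys m. point z i ^ Poly_Mapping.lookup m i)"
      using le[OF m]
      by (subst entire_eval_mult) (auto simp: entire_const entire_eval_const entire_prod entire_power entire)
  qed simp
  finally show ?thesis .
qed

lemma form_compose_nonzero:
  assumes "is_form N d Q" "\<not> range (\<lambda>z. proj_point N (point z)) \<subseteq> zero_locus N {Q}"
  shows "form_compose Q F \<noteq> 0"
proof
  assume 0: "form_compose Q F = 0"
  have "proj_point N (point z) \<in> zero_locus N {Q}" for z
    using assms(1) entire_eval_form_compose[OF assms(1), of z]
    by (intro proj_point_in_zero_locus point_nonzero) (auto simp: 0 entire_eval_zero)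
  with assms(2) show False by auto
qed

text \<open>The curve in the affine chart \<open>x\<^sub>k = 1\<close>; a junk value where \<open>F k\<close> vanishes.\<close>

definition chart :: "nat \<Rightarrow> 'k \<Rightarrow> nat \<Rightarrow> 'k" where
  "chart k z = (\<lambda>i. inverse (entire_eval (F k) z) * point z i)"

text \<open>A high power of \<open>F k\<close> clears the denominators of h(F/F_k), and each
  monomial becomes a form of degree \<open>M\<close> in the components. All \<open>M\<close> beyond
  \<open>D\<close> are covered, since a sum needs one exponent for both summands.\<close>

lemma homogenise:
  assumes k: "k \<le> N" and "h \<in> polyfun {..N}"
  shows "\<exists>D. \<forall>M\<ge>D. \<exists>G. dominated M G \<and>
           (\<forall>z. entire_eval (F k) z \<noteq> 0 \<longrightarrow>
                entire_eval G z = entire_eval (F k) z ^ M * h (chart k z))"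
  using assms(2)
proof (induction rule: polyfun.induct)
  case (const c)
  have "dominated M (fps_const c * F k ^ M)" for M
    using dominated_mult[OF dominated_const dominated_component_power[OF k]] by simp
  moreover have "entire_eval (fps_const c * F k ^ M) z = entire_eval (F k) z ^ M * c" for M z
    by (simp add: entire_eval_mult entire_const entire_power entire k entire_eval_const
        entire_eval_power)
  ultimately show ?case by blast
next
  case (var i)
  hence i: "i \<le> N" by simp
  have "dominated M (F i * F k ^ (M - 1))" if "M \<ge> 1" for M
    using dominated_mult[OF dominated_component[OF i] dominated_component_power[OF k, of "M - 1"]]
      that by simp
  moreover have "entire_eval (F i * F k ^ (M - 1)) z = entire_eval (F k) z ^ M * chart k z i"
    if "M \<ge> 1" "entire_eval (F k) z \<noteq> 0" for M z
    using that i
    by (cases M) (auto simp: entire_eval_mult entire_power entire k entire_eval_power chart_def point_def)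
  ultimately show ?case by blast
next
  case (add p q)
  then obtain D1 D2 where D1: "\<forall>M\<ge>D1. \<exists>G. dominated M G \<and> (\<forall>z. entire_eval (F k) z \<noteq> 0 \<longrightarrow>
                entire_eval G z = entire_eval (F k) z ^ M * p (chart k z))"
    and D2: "\<forall>M\<ge>D2. \<exists>G. dominated M G \<and> (\<forall>z. entire_eval (F k) z \<noteq> 0 \<longrightarrow>
                entire_eval G z = entire_eval (F k) z ^ M * q (chart k z))"
    by blast
  show ?case
  proof (intro exI[of _ "D1 + D2"] allI impI)
    fix M assume M: "M \<ge> D1 + D2"
    from D1 M obtain G where G: "dominated M G" "\<And>z. entire_eval (F k) z \<noteq> 0 \<Longrightarrow>
                entire_eval G z = entire_eval (F k) z ^ M * p (chart k z)"
      by (meson add_leD1)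
    from D2 M obtain H where H: "dominated M H" "\<And>z. entire_eval (F k) z \<noteq> 0 \<Longrightarrow>
                entire_eval H z = entire_eval (F k) z ^ M * q (chart k z)"
      by (meson add_leD2)
    show "\<exists>G. dominated M G \<and> (\<forall>z. entire_eval (F k) z \<noteq> 0 \<longrightarrow>
                entire_eval G z = entire_eval (F k) z ^ M * (p + q) (chart k z))"
      using G H dominated_add[OF G(1) H(1)]
      by (intro exI[of _ "G + H"]) (auto simp: entire_eval_add dominated_entire algebra_simps)
  qed
next
  case (mult p q)
  then obtain D1 D2 where D1: "\<forall>M\<ge>D1. \<exists>G. dominated M G \<and> (\<forall>z. entire_eval (F k) z \<noteq> 0 \<longrightarrow>
                entire_eval G z = entire_eval (F k) z ^ M * p (chart k z))"
    and D2: "\<forall>M\<ge>D2. \<exists>G. dominated M G \<and> (\<forall>z. entire_eval (F k) z \<noteq> 0 \<longrightarrow>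
                entire_eval G z = entire_eval (F k) z ^ M * q (chart k z))"
    by blast
  show ?case
  proof (intro exI[of _ "D1 + D2"] allI impI)
    fix M assume M: "M \<ge> D1 + D2"
    \<comment> \<open>The exponent \<open>M\<close> is split: \<open>G\<close> takes exactly
      \<open>D1\<close>, and the rest is at least \<open>D2\<close>, enough for
      \<open>H\<close>.\<close>
    from D1 obtain G where G: "dominated D1 G" "\<And>z. entire_eval (F k) z \<noteq> 0 \<Longrightarrow>
                entire_eval G z = entire_eval (F k) z ^ D1 * p (chart k z)"
      by blast
    from D2 M obtain H where H: "dominated (M - D1) H" "\<And>z. entire_eval (F k) z \<noteq> 0 \<Longrightarrow>
                entire_eval H z = entire_eval (F k) z ^ (M - D1) * q (chart k z)"
      by (metis le_diff_conv2 add.commute add_leD1)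
    have "dominated M (G * H)"
      using dominated_mult[OF G(1) H(1)] M by simp
    moreover have "entire_eval (G * H) z = entire_eval (F k) z ^ M * (p * q) (chart k z)"
      if "entire_eval (F k) z \<noteq> 0" for z
      using G H that M power_add[of "entire_eval (F k) z" D1 "M - D1"]
      by (simp add: entire_eval_mult dominated_entire)
    ultimately show "\<exists>G. dominated M G \<and> (\<forall>z. entire_eval (F k) z \<noteq> 0 \<longrightarrow>
                entire_eval G z = entire_eval (F k) z ^ M * (p * q) (chart k z))"
      by blast
  qed
qed

text \<open>
  An ideal that contains the equations of \<open>X\<close>, the \<open>Q j\<close> and \<open>x\<^sub>k - 1\<close>, to which the
  Nullstellensatz is applied.
\<close>

definition controlled :: "nat \<Rightarrow> 'j set \<Rightarrow> ('j \<Rightarrow> 'k mpoly) \<Rightarrow> ((nat \<Rightarrow> 'k) \<Rightarrow> 'k) set" where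
  "controlled k J Q = {p. \<exists>D. \<forall>M\<ge>D. \<exists>G. (\<forall>j\<in>J. dominated M (G j)) \<and>
      (\<forall>z. entire_eval (F k) z \<noteq> 0 \<longrightarrow>
         entire_eval (F k) z ^ M * p (chart k z) =
           (\<Sum>j\<in>J. entire_eval (G j) z * mpoly_eval (chart k z) (Q j)))}"

lemma controlledI:
  assumes "\<And>M. M \<ge> D \<Longrightarrow> \<exists>G. (\<forall>j\<in>J. dominated M (G j)) \<and>
      (\<forall>z. entire_eval (F k) z \<noteq> 0 \<longrightarrow>
         entire_eval (F k) z ^ M * p (chart k z) =
           (\<Sum>j\<in>J. entire_eval (G j) z * mpoly_eval (chart k z) (Q j)))"
  shows "p \<in> controlled k J Q"
  using assms unfolding controlled_def by blast

text \<open>All coefficients \<open>G j\<close> can be 0. In this way the equations of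
  \<open>X\<close>, which vanish along the curve, and x_k - 1 enter the ideal.\<close>

lemma controlled_vanishing:
  assumes "\<And>z. entire_eval (F k) z \<noteq> 0 \<Longrightarrow> p (chart k z) = 0"
  shows "p \<in> controlled k J Q"
  using assms by (intro controlledI exI[of _ "\<lambda>_. 0"])
    (auto simp: dominated_zero entire_eval_zero)

lemma controlled_add:
  assumes "p \<in> controlled k J Q" "q \<in> controlled k J Q"
  shows "p + q \<in> controlled k J Q"
proof -
  from assms obtain D1 D2
    where D1: "\<forall>M\<ge>D1. \<exists>G. (\<forall>j\<in>J. dominated M (G j)) \<and> (\<forall>z. entire_eval (F k) z \<noteq> 0 \<longrightarrow>
         entire_eval (F k) z ^ M * p (chart k z) =
           (\<Sum>j\<in>J. entire_eval (G j) z * mpoly_eval (chart k z) (Q j)))"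
    and D2: "\<forall>M\<ge>D2. \<exists>G. (\<forall>j\<in>J. dominated M (G j)) \<and> (\<forall>z. entire_eval (F k) z \<noteq> 0 \<longrightarrow>
         entire_eval (F k) z ^ M * q (chart k z) =
           (\<Sum>j\<in>J. entire_eval (G j) z * mpoly_eval (chart k z) (Q j)))"
    unfolding controlled_def by blast
  show ?thesis
  proof (rule controlledI[of "D1 + D2"])
    fix M assume M: "M \<ge> D1 + D2"
    from D1 M obtain G where G: "\<And>j. j \<in> J \<Longrightarrow> dominated M (G j)"
      "\<And>z. entire_eval (F k) z \<noteq> 0 \<Longrightarrow> entire_eval (F k) z ^ M * p (chart k z) =
           (\<Sum>j\<in>J. entire_eval (G j) z * mpoly_eval (chart k z) (Q j))"
      by (meson add_leD1)
    from D2 M obtain H where H: "\<And>j. j \<in> J \<Longrightarrow> dominated M (H j)"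
      "\<And>z. entire_eval (F k) z \<noteq> 0 \<Longrightarrow> entire_eval (F k) z ^ M * q (chart k z) =
           (\<Sum>j\<in>J. entire_eval (H j) z * mpoly_eval (chart k z) (Q j))"
      by (meson add_leD2)
    show "\<exists>G. (\<forall>j\<in>J. dominated M (G j)) \<and> (\<forall>z. entire_eval (F k) z \<noteq> 0 \<longrightarrow>
         entire_eval (F k) z ^ M * (p + q) (chart k z) =
           (\<Sum>j\<in>J. entire_eval (G j) z * mpoly_eval (chart k z) (Q j)))"
    proof (intro exI[of _ "\<lambda>j. G j + H j"] conjI ballI allI impI)
      fix z assume "entire_eval (F k) z \<noteq> 0"
      moreover have "(\<Sum>j\<in>J. entire_eval (G j + H j) z * mpoly_eval (chart k z) (Q j)) =
          (\<Sum>j\<in>J. entire_eval (G j) z * mpoly_eval (chart k z) (Q j) +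
            entire_eval (H j) z * mpoly_eval (chart k z) (Q j))"
        using dominated_entire[OF G(1)] dominated_entire[OF H(1)]
        by (intro sum.cong) (simp_all add: entire_eval_add distrib_right)
      ultimately show "entire_eval (F k) z ^ M * (p + q) (chart k z) =
           (\<Sum>j\<in>J. entire_eval (G j + H j) z * mpoly_eval (chart k z) (Q j))"
        using G(2) H(2) by (simp add: distrib_left sum.distrib)
    qed (use G H in \<open>auto intro: dominated_add\<close>)
  qed
qed

lemma controlled_mult:
  assumes k: "k \<le> N" and h: "h \<in> polyfun {..N}" and p: "p \<in> controlled k J Q"
  shows "h * p \<in> controlled k J Q"
proof -
  obtain D1 where D1: "\<forall>M\<ge>D1. \<exists>G. dominated M G \<and> (\<forall>z. entire_eval (F k) z \<noteq> 0 \<longrightarrow>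
                entire_eval G z = entire_eval (F k) z ^ M * h (chart k z))"
    using homogenise[OF k h] by blast
  obtain D2 where D2: "\<forall>M\<ge>D2. \<exists>G. (\<forall>j\<in>J. dominated M (G j)) \<and>
      (\<forall>z. entire_eval (F k) z \<noteq> 0 \<longrightarrow> entire_eval (F k) z ^ M * p (chart k z) =
           (\<Sum>j\<in>J. entire_eval (G j) z * mpoly_eval (chart k z) (Q j)))"
    using p unfolding controlled_def by blast
  show ?thesis
  proof (rule controlledI[of "D1 + D2"])
    fix M assume M: "M \<ge> D1 + D2"
    from D1 obtain H where H: "dominated D1 H" "\<And>z. entire_eval (F k) z \<noteq> 0 \<Longrightarrow>
                entire_eval H z = entire_eval (F k) z ^ D1 * h (chart k z)"
      by blast
    have "M - D1 \<ge> D2" using M by simp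
    with D2 obtain G where G: "\<And>j. j \<in> J \<Longrightarrow> dominated (M - D1) (G j)"
      "\<And>z. entire_eval (F k) z \<noteq> 0 \<Longrightarrow> entire_eval (F k) z ^ (M - D1) * p (chart k z) =
           (\<Sum>j\<in>J. entire_eval (G j) z * mpoly_eval (chart k z) (Q j))"
      by blast
    have "dominated M (H * G j)" if "j \<in> J" for j
      using dominated_mult[OF H(1) G(1)[OF that]] M by simp
    moreover have "entire_eval (F k) z ^ M * (h * p) (chart k z) =
           (\<Sum>j\<in>J. entire_eval (H * G j) z * mpoly_eval (chart k z) (Q j))"
      if z: "entire_eval (F k) z \<noteq> 0" for z
    proof -
      have "entire_eval (F k) z ^ M * (h * p) (chart k z) =
          entire_eval H z * (entire_eval (F k) z ^ (M - D1) * p (chart k z))"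
        using H(2)[OF z] power_add[of "entire_eval (F k) z" D1 "M - D1"] M by simp
      also have "\<dots> = (\<Sum>j\<in>J. entire_eval (H * G j) z * mpoly_eval (chart k z) (Q j))"
        unfolding G(2)[OF z] sum_distrib_left
        using dominated_entire[OF H(1)] dominated_entire[OF G(1)]
        by (intro sum.cong) (simp_all add: entire_eval_mult mult.assoc)
      finally show ?thesis .
    qed
    ultimately show "\<exists>G. (\<forall>j\<in>J. dominated M (G j)) \<and> (\<forall>z. entire_eval (F k) z \<noteq> 0 \<longrightarrow>
         entire_eval (F k) z ^ M * (h * p) (chart k z) =
           (\<Sum>j\<in>J. entire_eval (G j) z * mpoly_eval (chart k z) (Q j)))"
      by (intro exI[of _ "\<lambda>j. H * G j"]) blast
  qed
qed

lemma controlled_generator: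
  assumes k: "k \<le> N" and j: "j \<in> J" "finite J"
  shows "(\<lambda>v. mpoly_eval v (Q j)) \<in> controlled k J Q"
proof (rule controlledI[of 0])
  fix M :: nat
  have "(\<Sum>i\<in>J. entire_eval (if i = j then F k ^ M else 0) z * mpoly_eval (chart k z) (Q i)) =
      (\<Sum>i\<in>J. if i = j then entire_eval (F k ^ M) z * mpoly_eval (chart k z) (Q j) else 0)" for z
    by (intro sum.cong) (auto simp: entire_eval_zero)
  also have "\<dots> z = entire_eval (F k) z ^ M * mpoly_eval (chart k z) (Q j)" for z
    using j by (simp add: entire_eval_power entire k)
  finally show "\<exists>G. (\<forall>i\<in>J. dominated M (G i)) \<and> (\<forall>z. entire_eval (F k) z \<noteq> 0 \<longrightarrow>
         entire_eval (F k) z ^ M * mpoly_eval (chart k z) (Q j) =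
           (\<Sum>i\<in>J. entire_eval (G i) z * mpoly_eval (chart k z) (Q i)))"
    using k by (intro exI[of _ "\<lambda>i. if i = j then F k ^ M else 0"])
      (auto simp: dominated_zero dominated_component_power)
qed

text \<open>Otherwise the Nullstellensatz yields a common zero \<open>v\<close> of the polynomial
  functions in \<open>controlled k J Q\<close>. The member x_k - 1 keeps it away from the origin, so
  it represents a point at which all of \<open>S\<close> and all \<open>Q j\<close> vanish, against
  \<open>no_zero\<close>.\<close>

lemma one_controlled:
  assumes k: "k \<le> N" and J: "finite J"
    and forms: "\<And>j. j \<in> J \<Longrightarrow> is_form N (d j) (Q j)"
    and S_forms: "\<And>P. P \<in> S \<Longrightarrow> \<exists>e. is_form N e P"
    and S_zero: "\<And>P z. P \<in> S \<Longrightarrow> mpoly_eval (point z) P = 0"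
    and no_zero: "\<And>v. v \<in> nonzero_vecs N \<Longrightarrow> (\<And>P. P \<in> S \<Longrightarrow> mpoly_eval v P = 0) \<Longrightarrow>
        \<exists>j\<in>J. mpoly_eval v (Q j) \<noteq> 0"
  shows "1 \<in> controlled k J Q"
proof (rule ccontr)
  assume "1 \<notin> controlled k J Q"
  moreover have "0 \<in> controlled k J Q"
    by (rule controlled_vanishing) simp
  ultimately obtain v where v: "\<And>p. p \<in> controlled k J Q \<Longrightarrow> p \<in> polyfun {..N} \<Longrightarrow> p v = 0"
    using weak_nullstellensatz[of "{..N}" "controlled k J Q"] controlled_add controlled_mult[OF k]
    by blast
  \<comment> \<open>The coordinates of \<open>v\<close> beyond \<open>N\<close> are arbitrary,
    whereas members of \<open>nonzero_vecs N\<close> vanish there; forms in the variables up to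
    \<open>N\<close> do not see the change.\<close>
  define w where "w = (\<lambda>i. if i \<le> N then v i else 0)"
  have w: "mpoly_eval w P = mpoly_eval v P" if "is_form N e P" for e P
    using polyfun_cong[OF mpoly_eval_polyfun[OF that], of w v] by (simp add: w_def)
  have "(\<lambda>v. v k) + (\<lambda>v. - 1) \<in> controlled k J Q"
    using k by (intro controlled_vanishing) (simp add: chart_def point_def)
  moreover have "(\<lambda>v. v k) + (\<lambda>v. - 1) \<in> polyfun {..N}"
    using k by (intro polyfun.add polyfun.var polyfun.const) auto
  ultimately have "((\<lambda>v. v k) + (\<lambda>v. - 1)) v = 0" by (rule v)
  hence "v k = 1" by simp
  hence "w \<in> nonzero_vecs N"
    using k by (auto simp: w_def nonzero_vecs_def intro!: exI[of _ k])
  moreover have "mpoly_eval w P = 0" if P: "P \<in> S" for P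
  proof -
    obtain e where e: "is_form N e P" using S_forms[OF P] by blast
    have "(\<lambda>v. mpoly_eval v P) \<in> controlled k J Q"
      using S_zero[OF P] mpoly_eval_scale[OF e]
      by (intro controlled_vanishing) (simp add: chart_def)
    from v[OF this mpoly_eval_polyfun[OF e]] show ?thesis by (simp add: w[OF e])
  qed
  ultimately obtain j where j: "j \<in> J" "mpoly_eval w (Q j) \<noteq> 0"
    using no_zero by blast
  have "mpoly_eval v (Q j) = 0"
    using v[OF controlled_generator[OF k j(1) J] mpoly_eval_polyfun[OF forms[OF j(1)]]] .
  with j w[OF forms[OF j(1)]] show False by simp
qed

text \<open>If every composed form were small compared with \<open>nrm r ^ d j\<close>, all terms on
  the right of F_k^(M+L) = \<Sum> H_j Q_j(F) would have Gauss norm at most half of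
  \<open>nrm r ^ (M + L)\<close>, which is the norm of the left side when \<open>F k\<close> is a
  largest component.\<close>

lemma form_bound_chart:
  assumes k: "k \<le> N" and J: "finite J"
    and forms: "\<And>j. j \<in> J \<Longrightarrow> is_form N (d j) (Q j)"
    and one: "1 \<in> controlled k J Q"
  shows "\<exists>C>0. \<forall>r>0. gauss_norm (F k) r = nrm r \<longrightarrow>
           (\<exists>j\<in>J. nrm r ^ d j \<le> C * gauss_norm (form_compose (Q j) F) r)"
proof -
  obtain M G where dom: "\<And>j. j \<in> J \<Longrightarrow> dominated M (G j)"
    and eq: "\<And>z. entire_eval (F k) z \<noteq> 0 \<Longrightarrow> entire_eval (F k) z ^ M =
           (\<Sum>j\<in>J. entire_eval (G j) z * mpoly_eval (chart k z) (Q j))"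
    using one unfolding controlled_def by fastforce
  \<comment> \<open>\<open>L\<close> exceeds every \<open>d j\<close>, so the factor
    \<open>F k ^ (L - d j)\<close> of \<open>H j\<close> has positive exponent: at zeros of
    \<open>F k\<close> both sides of the identity are 0.\<close>
  define L where "L = Suc (sum d J)"
  have L: "d j < L" if "j \<in> J" for j
    using member_le_sum[of j J d] that J by (simp add: L_def)
  define H where "H j = G j * F k ^ (L - d j)" for j
  have H: "dominated (M + (L - d j)) (H j)" if "j \<in> J" for j
    unfolding H_def using that k by (intro dominated_mult dom dominated_component_power)
  have ent: "entire (form_compose (Q j) F)" "entire (H j)" "entire (G j)" if "j \<in> J" for j
    using that entire_form_compose[OF forms] H dom dominated_entire by blast+
  have "F k ^ (M + L) = (\<Sum>j\<in>J. H j * form_compose (Q j) F)"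
  proof (rule entire_eqI)
    show "infinite (UNIV :: 'k set)" by (rule infinite_UNIV_alg_closed_field)
    show "entire (F k ^ (M + L))" "entire (\<Sum>j\<in>J. H j * form_compose (Q j) F)"
      using k ent by (auto intro!: entire_power entire_sum entire_mult entire)
    fix z
    define c where "c = entire_eval (F k) z"
    have "c ^ (M + L) = (\<Sum>j\<in>J. entire_eval (G j) z * c ^ (L - d j) * mpoly_eval (point z) (Q j))"
    proof (cases "c = 0")
      case True
      hence "entire_eval (G j) z * c ^ (L - d j) * mpoly_eval (point z) (Q j) = 0"
        if "j \<in> J" for j
        using L[OF that] by (simp add: power_0_left)
      hence "(\<Sum>j\<in>J. entire_eval (G j) z * c ^ (L - d j) * mpoly_eval (point z) (Q j)) = 0"
        by (intro sum.neutral ballI)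
      moreover have "c ^ (M + L) = 0" using True by (simp add: L_def)
      ultimately show ?thesis by (simp only:)
    next
      case False
      have "c ^ (M + L) = c ^ M * c ^ L" by (rule power_add)
      also have "\<dots> = (\<Sum>j\<in>J. entire_eval (G j) z * mpoly_eval (chart k z) (Q j) * c ^ L)"
        using eq[of z] False by (simp add: c_def sum_distrib_right)
      also have "\<dots> = (\<Sum>j\<in>J. entire_eval (G j) z * c ^ (L - d j) * mpoly_eval (point z) (Q j))"
      proof (rule sum.cong)
        fix j assume j: "j \<in> J"
        have "mpoly_eval (chart k z) (Q j) = inverse c ^ d j * mpoly_eval (point z) (Q j)"
          unfolding chart_def c_def using mpoly_eval_scale[OF forms[OF j]] .
        moreover have "c ^ L = c ^ d j * c ^ (L - d j)"
          using L[OF j] by (simp flip: power_add)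
        ultimately show "entire_eval (G j) z * mpoly_eval (chart k z) (Q j) * c ^ L =
            entire_eval (G j) z * c ^ (L - d j) * mpoly_eval (point z) (Q j)"
          using False by (simp add: power_inverse field_simps)
      qed simp
      finally show ?thesis .
    qed
    also have "\<dots> = entire_eval (\<Sum>j\<in>J. H j * form_compose (Q j) F) z"
      using ent k
      by (subst entire_eval_sum)
         (auto simp: H_def entire_mult entire_eval_mult entire_power entire entire_eval_power
           entire_eval_form_compose[OF forms] c_def intro!: sum.cong)
    finally show "entire_eval (F k ^ (M + L)) z = entire_eval (\<Sum>j\<in>J. H j * form_compose (Q j) F) z"
      using k by (simp add: entire_eval_power entire c_def)
  qed note id = this
  have "\<forall>j\<in>J. \<exists>C\<ge>0. \<forall>r>0. gauss_norm (H j) r \<le> C * nrm r ^ (M + (L - d j))"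
    using H by (auto simp: dominated_def)
  then obtain C where C: "\<And>j. j \<in> J \<Longrightarrow> C j \<ge> 0"
    "\<And>j r. j \<in> J \<Longrightarrow> r > 0 \<Longrightarrow> gauss_norm (H j) r \<le> C j * nrm r ^ (M + (L - d j))"
    by metis
  define C0 where "C0 = 1 + sum C J"
  have C0: "C j \<le> C0" if "j \<in> J" for j
    using member_le_sum[of j J C] that C J by (simp add: C0_def)
  have C0_pos: "C0 > 0"
    using sum_nonneg[of J C] C by (simp add: C0_def add_pos_nonneg)
  have "\<exists>j\<in>J. nrm r ^ d j \<le> 2 * C0 * gauss_norm (form_compose (Q j) F) r"
    if r: "r > 0" and max: "gauss_norm (F k) r = nrm r" for r
  proof (rule ccontr)
    assume "\<not> ?thesis"
    hence less: "2 * C0 * gauss_norm (form_compose (Q j) F) r < nrm r ^ d j" if "j \<in> J" for j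
      using that by force
    have pos: "nrm r > 0" using nrm_pos[OF r] .
    have "nrm r ^ (M + L) = gauss_norm (F k ^ (M + L)) r"
      using gauss_norm_power[OF entire[OF k] r] max by simp
    also have "\<dots> \<le> nrm r ^ (M + L) / 2"
      unfolding id
    proof (rule gauss_norm_sum_le)
      fix j assume j: "j \<in> J"
      show "entire (H j * form_compose (Q j) F)" using ent j by (intro entire_mult)
      have "gauss_norm (H j * form_compose (Q j) F) r \<le>
          gauss_norm (H j) r * gauss_norm (form_compose (Q j) F) r"
        using ent j r by (intro gauss_norm_mult_le) auto
      also have "\<dots> \<le> (C0 * nrm r ^ (M + (L - d j))) * (nrm r ^ d j / (2 * C0))"
      proof (intro mult_mono)
        show "gauss_norm (H j) r \<le> C0 * nrm r ^ (M + (L - d j))"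
          using C(2)[OF j r] C0[OF j] pos
          by (meson mult_right_mono order_trans less_imp_le zero_le_power)
        show "gauss_norm (form_compose (Q j) F) r \<le> nrm r ^ d j / (2 * C0)"
          using less[OF j] C0_pos by (simp add: field_simps)
      qed (use C0_pos pos ent j r in \<open>auto intro!: gauss_norm_nonneg\<close>)
      also have "\<dots> = nrm r ^ (M + L) / 2"
        using C0_pos L[OF j] by (simp add: field_simps flip: power_add)
      finally show "gauss_norm (H j * form_compose (Q j) F) r \<le> nrm r ^ (M + L) / 2" .
    qed (use r pos in auto)
    finally show False using zero_less_power[OF pos, of "M + L"] by simp
  qed
  thus ?thesis using C0_pos by (intro exI[of _ "2 * C0"]) auto
qed

text \<open>At each radius some component attains the norm, and the estimate in its chart applies.
  There are finitely many charts, so the sum of their constants serves every radius.\<close>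

lemma form_bound:
  assumes J: "finite J"
    and forms: "\<And>j. j \<in> J \<Longrightarrow> is_form N (d j) (Q j)"
    and S_forms: "\<And>P. P \<in> S \<Longrightarrow> \<exists>e. is_form N e P"
    and S_zero: "\<And>P z. P \<in> S \<Longrightarrow> mpoly_eval (point z) P = 0"
    and no_zero: "\<And>v. v \<in> nonzero_vecs N \<Longrightarrow> (\<And>P. P \<in> S \<Longrightarrow> mpoly_eval v P = 0) \<Longrightarrow>
        \<exists>j\<in>J. mpoly_eval v (Q j) \<noteq> 0"
  shows "\<exists>C>0. \<forall>r>0. \<exists>j\<in>J. nrm r ^ d j \<le> C * gauss_norm (form_compose (Q j) F) r"
proof -
  have "\<exists>C>0. \<forall>r>0. gauss_norm (F k) r = nrm r \<longrightarrow>
           (\<exists>j\<in>J. nrm r ^ d j \<le> C * gauss_norm (form_compose (Q j) F) r)" if "k \<le> N" for k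
    by (rule form_bound_chart[where d = d, OF that J forms
          one_controlled[where d = d and S = S, OF that J forms S_forms S_zero no_zero]])
  then obtain C where C: "\<And>k. k \<le> N \<Longrightarrow> C k > 0"
    "\<And>k r. k \<le> N \<Longrightarrow> r > 0 \<Longrightarrow> gauss_norm (F k) r = nrm r \<Longrightarrow>
           \<exists>j\<in>J. nrm r ^ d j \<le> C k * gauss_norm (form_compose (Q j) F) r"
    by metis
  define C0 where "C0 = sum C {..N}"
  have "C0 > 0" unfolding C0_def using C by (intro sum_pos) auto
  moreover have "\<exists>j\<in>J. nrm r ^ d j \<le> C0 * gauss_norm (form_compose (Q j) F) r" if r: "r > 0" for r
  proof -
    obtain k where k: "k \<le> N" "gauss_norm (F k) r = nrm r" using nrm_attained by blast
    then obtain j where j: "j \<in> J" "nrm r ^ d j \<le> C k * gauss_norm (form_compose (Q j) F) r"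
      using C(2) r by blast
    have "C k \<le> C0"
      unfolding C0_def using C k by (intro member_le_sum) (auto simp: less_imp_le)
    hence "C k * gauss_norm (form_compose (Q j) F) r \<le> C0 * gauss_norm (form_compose (Q j) F) r"
      using gauss_norm_nonneg[OF entire_form_compose[OF forms[OF j(1)]], of r] r
      by (intro mult_right_mono) auto
    with j show ?thesis by force
  qed
  ultimately show ?thesis by blast
qed

end

section \<open>The defect relation\<close>

text \<open>Superadditivity of the lower limit, one summand at a time; nonnegativity keeps the sums
  clear of \<infinity> - \<infinity>.\<close>

lemma sum_Liminf_le:
  fixes f :: "'i \<Rightarrow> 'b \<Rightarrow> ereal"
  assumes "F \<noteq> bot" "\<And>i x. i \<in> S \<Longrightarrow> f i x \<ge> 0"
  shows "(\<Sum>i\<in>S. Liminf F (f i)) \<le> Liminf F (\<lambda>x. \<Sum>i\<in>S. f i x)"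
  using assms(2)
proof (induction S rule: infinite_finite_induct)
  case (insert i S)
  have "(\<Sum>i\<in>insert i S. Liminf F (f i)) \<le> Liminf F (f i) + Liminf F (\<lambda>x. \<Sum>i\<in>S. f i x)"
    using insert by (simp add: add_left_mono)
  also have "\<dots> \<le> Liminf F (\<lambda>x. f i x + (\<Sum>i\<in>S. f i x))"
    using insert.prems assms(1) by (intro Liminf_add_le always_eventually allI sum_nonneg) auto
  finally show ?case using insert by simp
qed (use assms(1) in \<open>simp_all add: Liminf_const\<close>)

text \<open>Quotients of proximity by characteristic may be negative, as the coefficients of the
  forms are not normalised, while superadditivity is at hand for nonnegative functions. Truncation
  at 0 only raises the left side, so a bound for the truncated sum suffices.\<close>

lemma sum_Liminf_bound:
  fixes f :: "'i \<Rightarrow> real \<Rightarrow> real"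
  assumes bound: "\<forall>\<^sub>F r in at_top. (\<Sum>i\<in>S. max (f i r) 0) \<le> b + e r"
    and e: "(e \<longlongrightarrow> 0) at_top"
  shows "(\<Sum>i\<in>S. Liminf at_top (\<lambda>r. ereal (f i r))) \<le> ereal b"
proof -
  have "(\<Sum>i\<in>S. Liminf at_top (\<lambda>r. ereal (f i r))) \<le>
      (\<Sum>i\<in>S. Liminf at_top (\<lambda>r. ereal (max (f i r) 0)))"
    by (intro sum_mono Liminf_mono always_eventually allI) simp
  also have "\<dots> \<le> Liminf at_top (\<lambda>r. \<Sum>i\<in>S. ereal (max (f i r) 0))"
    by (rule sum_Liminf_le) (auto simp flip: ereal_max)
  also have "\<dots> \<le> Liminf at_top (\<lambda>r. ereal (b + e r))"
    using bound by (intro Liminf_mono) (simp only: sum_ereal ereal_less_eq)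
  also have "\<dots> = ereal b"
  proof (rule lim_imp_Liminf)
    have "((\<lambda>r. b + e r) \<longlongrightarrow> b + 0) at_top"
      by (intro tendsto_intros e)
    thus "((\<lambda>r. ereal (b + e r)) \<longlongrightarrow> ereal b) at_top" by simp
  qed simp
  finally show ?thesis .
qed

text \<open>The term of any single nonzero coefficient does not decrease for
  \<open>r \<ge> 1\<close>. For a composed form this is the source of the upper bound d T + O(1) on
  its proximity.\<close>

lemma gauss_norm_lower_bound:
  assumes "entire g" "g \<noteq> 0"
  shows "\<exists>c>0. \<forall>r\<ge>1. c \<le> gauss_norm g r"
proof -
  obtain j where j: "fps_nth g j \<noteq> 0" using assms(2) by (auto simp: fps_eq_iff)
  have "absv (fps_nth g j) \<le> gauss_norm g r" if "r \<ge> 1" for r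
  proof -
    have "absv (fps_nth g j) * 1 \<le> absv (fps_nth g j) * r ^ j"
      using that by (intro mult_left_mono) (auto simp: absv_nonneg)
    thus ?thesis using gauss_norm_ge[OF assms(1), of r j] that by simp
  qed
  thus ?thesis using j by (auto simp: absv_pos_iff intro!: exI[of _ "absv (fps_nth g j)"])
qed

context analytic_curve
begin

text \<open>A nonconstant component has a nonzero coefficient of positive index, whose term in the
  Gauss norm grows at least linearly. The characteristic thus tends to infinity, and bounded errors
  disappear from the defects.\<close>

lemma nrm_at_top:
  assumes i: "i \<le> N" and "entire_eval (F i) z \<noteq> entire_eval (F i) w"
  shows "filterlim nrm at_top at_top"
proof -
  have "\<exists>j\<ge>1. fps_nth (F i) j \<noteq> 0"
  proof (rule ccontr)
    assume "\<not> ?thesis"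
    hence "fps_nth (F i) j = 0" if "j \<noteq> 0" for j
      using that by (metis One_nat_def Suc_leI neq0_conv)
    hence "F i = fps_const (fps_nth (F i) 0)"
      by (intro fps_ext) auto
    with assms(2) show False by (metis entire_eval_const)
  qed
  then obtain j where j: "j \<ge> 1" "fps_nth (F i) j \<noteq> 0" by blast
  define c where "c = absv (fps_nth (F i) j)"
  have c: "c > 0" using j by (simp add: c_def absv_pos_iff)
  have "c * r \<le> nrm r" if "r \<ge> 1" for r
  proof -
    have "c * r ^ 1 \<le> c * r ^ j"
      using that j c by (intro mult_left_mono power_increasing) auto
    thus ?thesis
      using gauss_norm_ge[OF entire[OF i], of r j] gauss_norm_le_nrm[OF i, of r] that
      by (simp add: c_def)
  qed
  hence "\<forall>\<^sub>F r in at_top. c * r \<le> nrm r"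
    using eventually_ge_at_top[of 1] by (rule eventually_mono[rotated])
  moreover have "filterlim (\<lambda>r. c * r) at_top at_top"
    using c by (intro filterlim_tendsto_pos_mult_at_top[OF tendsto_const] filterlim_ident)
  ultimately show ?thesis
    by (rule filterlim_at_top_mono[rotated])
qed

text \<open>
  At every radius at most \<open>n\<close> of the forms are small on the curve; for those the trivial
  bound \<open>m \<le> d T + O(1)\<close> suffices, and all others have bounded proximity.
\<close>

lemma sum_defect_le:
  assumes forms: "\<And>j. j \<in> J \<Longrightarrow> is_form N (d j) (Q j)" and d: "\<And>j. j \<in> J \<Longrightarrow> d j \<ge> 1"
    and J: "finite J"
    and nonzero: "\<And>j. j \<in> J \<Longrightarrow> form_compose (Q j) F \<noteq> 0"
    and bound: "\<And>I. I \<subseteq> J \<Longrightarrow> card I = n + 1 \<Longrightarrow>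
        \<exists>C>0. \<forall>r>0. \<exists>j\<in>I. nrm r ^ d j \<le> C * gauss_norm (form_compose (Q j) F) r"
    and unbounded: "filterlim nrm at_top at_top"
  shows "(\<Sum>j\<in>J. defect N F (d j) (Q j)) \<le> ereal (real n)"
proof -
  define g where "g j r = gauss_norm (form_compose (Q j) F) r" for j r
  define T where "T r = ln (nrm r)" for r
  define m where "m j r = proximity N F (d j) (Q j) r" for j r
  have g_pos: "g j r > 0" if "j \<in> J" "r > 0" for j r
    unfolding g_def using that by (intro gauss_norm_pos nonzero entire_form_compose[OF forms])
  have m_eq: "m j r = real (d j) * T r - ln (g j r)" if "j \<in> J" "r > 0" for j r
    using g_pos[OF that] nrm_pos[OF that(2)]
    by (simp add: m_def proximity_def T_def ln_div ln_realpow flip: g_def)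
  have "\<forall>j\<in>J. \<exists>c>0. \<forall>r\<ge>1. c \<le> g j r"
    unfolding g_def using gauss_norm_lower_bound[OF entire_form_compose[OF forms] nonzero] by blast
  then obtain c where c: "\<And>j. j \<in> J \<Longrightarrow> c j > 0" "\<And>j r. j \<in> J \<Longrightarrow> r \<ge> 1 \<Longrightarrow> c j \<le> g j r"
    by metis
  have "\<forall>I\<in>{I. I \<subseteq> J \<and> card I = n + 1}. \<exists>C>0. \<forall>r>0. \<exists>j\<in>I. nrm r ^ d j \<le> C * g j r"
    using bound unfolding g_def by blast
  then obtain C where C: "\<And>I. I \<subseteq> J \<Longrightarrow> card I = n + 1 \<Longrightarrow> C I > 0"
    "\<And>I r. I \<subseteq> J \<Longrightarrow> card I = n + 1 \<Longrightarrow> r > 0 \<Longrightarrow> \<exists>j\<in>I. nrm r ^ d j \<le> C I * g j r"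
    unfolding Ball_def mem_Collect_eq by metis
  \<comment> \<open>One constant, independent of the radius, dominates the bounds for all forms and
    all subsets, of which there are finitely many. \<open>C\<close> is unspecified at subsets of
    other cardinality; with absolute values these summands can only enlarge
    \<open>A\<close>.\<close>
  define A where "A = (\<Sum>j\<in>J. \<bar>ln (c j)\<bar>) + (\<Sum>I\<in>Pow J. \<bar>ln (C I)\<bar>)"
  have A_nonneg: "A \<ge> 0" unfolding A_def by (intro add_nonneg_nonneg sum_nonneg) auto
  have A_c: "- ln (c j) \<le> A" if "j \<in> J" for j
  proof -
    have "- ln (c j) \<le> \<bar>ln (c j)\<bar>" by simp
    also have "\<dots> \<le> (\<Sum>j\<in>J. \<bar>ln (c j)\<bar>)" using J that by (intro member_le_sum) auto
    finally show ?thesis unfolding A_def by (simp add: add_increasing2 sum_nonneg)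
  qed
  have A_C: "ln (C I) \<le> A" if "I \<subseteq> J" for I
  proof -
    have "ln (C I) \<le> \<bar>ln (C I)\<bar>" by simp
    also have "\<dots> \<le> (\<Sum>I\<in>Pow J. \<bar>ln (C I)\<bar>)" using J that by (intro member_le_sum) auto
    finally show ?thesis unfolding A_def by (simp add: add_increasing sum_nonneg)
  qed
  have trivial_bound: "m j r \<le> real (d j) * T r + A" if "j \<in> J" "r \<ge> 1" for j r
  proof -
    have "ln (c j) \<le> ln (g j r)" using c that g_pos[of j r] by simp
    thus ?thesis using m_eq[of j r] A_c[of j] that by simp
  qed
  define bad where "bad r = {j \<in> J. m j r > A}" for r
  have card_bad: "card (bad r) \<le> n" if r: "r > 0" for r
  proof (rule ccontr)
    assume "\<not> card (bad r) \<le> n"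
    then obtain I where I: "I \<subseteq> bad r" "card I = n + 1"
      using obtain_subset_with_card_n[of "n + 1" "bad r"] by auto
    have IJ: "I \<subseteq> J" using I by (auto simp: bad_def)
    obtain j where j: "j \<in> I" "nrm r ^ d j \<le> C I * g j r"
      using C(2)[OF IJ I(2) r] by blast
    have "ln (nrm r ^ d j) \<le> ln (C I * g j r)"
      using j nrm_pos[OF r] by (subst ln_le_cancel_iff) (auto intro: less_le_trans[of _ "nrm r ^ d j"])
    hence "real (d j) * T r \<le> ln (C I) + ln (g j r)"
      using C(1)[OF IJ I(2)] g_pos[of j r] j IJ r nrm_pos[OF r]
      by (simp add: T_def ln_mult ln_realpow subset_iff)
    hence "m j r \<le> A" using m_eq[of j r] A_C[OF IJ] j IJ r by auto
    with j I show False by (auto simp: bad_def)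
  qed
  have T_at_top: "filterlim T at_top at_top"
    unfolding T_def by (rule filterlim_compose[OF ln_at_top unbounded])
  \<comment> \<open>Each of the \<open>card J\<close> quotients has an error of at most
    \<open>A / T r\<close>, as \<open>d j\<close> is at least 1; \<open>e\<close> is their
    total.\<close>
  define e where "e r = real (card J) * A / T r" for r
  have e: "(e \<longlongrightarrow> 0) at_top"
    unfolding e_def by (rule real_tendsto_divide_at_top[OF tendsto_const T_at_top])
  have "(\<Sum>j\<in>J. max (m j r / (real (d j) * T r)) 0) \<le> real n + e r"
    if T: "T r > 0" and r: "r \<ge> 1" for r
  proof -
    have small: "A / (real (d j) * T r) \<le> A / T r" if "j \<in> J" for j
      using A_nonneg T d[OF that] by (intro divide_left_mono) auto
    have "(\<Sum>j\<in>J. max (m j r / (real (d j) * T r)) 0) \<le>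
        (\<Sum>j\<in>J. (if j \<in> bad r then 1 else 0) + A / T r)"
    proof (rule sum_mono)
      fix j assume j: "j \<in> J"
      have pos: "real (d j) * T r > 0" using d[OF j] T by simp
      have "m j r / (real (d j) * T r) \<le> (if j \<in> bad r then 1 else 0) + A / T r"
      proof (cases "j \<in> bad r")
        case True
        have "m j r / (real (d j) * T r) \<le> (real (d j) * T r + A) / (real (d j) * T r)"
          using trivial_bound[OF j r] pos by (intro divide_right_mono) auto
        also have "\<dots> = 1 + A / (real (d j) * T r)" using pos d[OF j] T by (simp add: add_divide_distrib)
        finally show ?thesis using True small[OF j] by simp
      next
        case False
        hence "m j r / (real (d j) * T r) \<le> A / (real (d j) * T r)"
          using j pos by (intro divide_right_mono) (auto simp: bad_def)
        thus ?thesis using False small[OF j] by simp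
      qed
      moreover have "0 \<le> (if j \<in> bad r then 1 else 0) + A / T r"
        using A_nonneg T by simp
      ultimately show "max (m j r / (real (d j) * T r)) 0 \<le>
          (if j \<in> bad r then 1 else 0) + A / T r" by simp
    qed
    also have "\<dots> = real (card (bad r)) + e r"
    proof -
      have "(\<Sum>j\<in>J. if j \<in> bad r then 1 else (0::real)) = real (card (J \<inter> bad r))"
        using J by (simp add: sum.If_cases Int_def)
      moreover have "J \<inter> bad r = bad r" by (auto simp: bad_def)
      ultimately show ?thesis by (simp add: sum.distrib e_def)
    qed
    also have "\<dots> \<le> real n + e r" using card_bad[of r] r by simp
    finally show ?thesis .
  qed
  moreover have "\<forall>\<^sub>F r in at_top. T r > 0 \<and> r \<ge> 1"
    using T_at_top by (intro eventually_conj eventually_ge_at_top) (simp add: filterlim_at_top_dense)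
  ultimately have "\<forall>\<^sub>F r in at_top. (\<Sum>j\<in>J. max (m j r / (real (d j) * T r)) 0) \<le> real n + e r"
    by (auto elim!: eventually_mono)
  from sum_Liminf_bound[OF this e] show ?thesis
    by (simp add: defect_def m_def T_def characteristic_def)
qed

end

theorem corollary1:
  fixes N n q :: nat
    and X :: "(nat \<Rightarrow> 'k::{alg_closed_field, nonarch_field, complete_space}) set set"
    and Q :: "nat \<Rightarrow> 'k mpoly"
    and d :: "nat \<Rightarrow> nat"
    and f :: "'k \<Rightarrow> (nat \<Rightarrow> 'k) set"
    and F :: "nat \<Rightarrow> 'k fps"
  assumes "projective_subvariety N X"
    and "variety_dim N X = enat n"
    and "n \<ge> 1"
    and "\<And>j. j \<in> {1..q} \<Longrightarrow> hypersurface_form N (d j) (Q j)"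
    and "general_position N X n q Q"
    and "reduced_rep N F f"
    and "range f \<subseteq> X"
    and "\<And>j. j \<in> {1..q} \<Longrightarrow> \<not> range f \<subseteq> zero_locus N {Q j}"
  shows "(\<Sum>j = 1..q. defect N F (d j) (Q j)) \<le> ereal (real n)"
proof -
  interpret analytic_curve N F
    using assms(6) by unfold_locales (auto simp: reduced_rep_def)
  have f: "f = (\<lambda>z. proj_point N (point z))"
    using assms(6) by (auto simp: reduced_rep_def point_def)
  obtain S where S: "\<And>P. P \<in> S \<Longrightarrow> \<exists>e. is_form N e P" "X = zero_locus N S"
    using assms(1) unfolding projective_subvariety_def zariski_closed_def by blast
  have S_zero: "mpoly_eval (point z) P = 0" if "P \<in> S" for P z
  proof -
    have "proj_point N (point z) \<in> zero_locus N S"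
      using assms(7) unfolding f S(2) by blast
    thus ?thesis using zero_locus_proj_pointD[OF point_nonzero] that by blast
  qed
  have forms: "is_form N (d j) (Q j)" "d j \<ge> 1" if "j \<in> {1..q}" for j
    using assms(4)[OF that] by (auto simp: hypersurface_form_def)
  show ?thesis
  proof (rule sum_defect_le)
    fix j assume j: "j \<in> {1..q}"
    show "is_form N (d j) (Q j)" "d j \<ge> 1" using forms[OF j] .
    show "form_compose (Q j) F \<noteq> 0"
      using form_compose_nonzero[OF forms(1)[OF j]] assms(8)[OF j] unfolding f by blast
  next
    fix I assume I: "I \<subseteq> {1..q}" "card I = n + 1"
    have empty: "X \<inter> zero_locus N (Q ` I) = {}"
      using assms(5) I by (auto simp: general_position_def)
    have I_forms: "is_form N (d j) (Q j)" if "j \<in> I" for j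
      using I that forms by blast
    show "\<exists>C>0. \<forall>r>0. \<exists>j\<in>I. curve_norm N F r ^ d j \<le> C * gauss_norm (form_compose (Q j) F) r"
    proof (rule form_bound[where S = S])
      show "finite I" using I(1) by (rule finite_subset) simp
      fix v assume v: "v \<in> nonzero_vecs N" "\<And>P. P \<in> S \<Longrightarrow> mpoly_eval v P = 0"
      show "\<exists>j\<in>I. mpoly_eval v (Q j) \<noteq> 0"
      proof (rule ccontr)
        assume "\<not> ?thesis"
        hence "proj_point N v \<in> zero_locus N (Q ` I)"
          using I_forms by (intro proj_point_in_zero_locus[OF v(1)]) auto
        moreover have "proj_point N v \<in> X"
          unfolding S(2) using S(1) v by (intro proj_point_in_zero_locus)
        ultimately show False using empty by blast
      qed
    qed (use I_forms S(1) S_zero in auto)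
  next
    show "filterlim (curve_norm N F) at_top at_top"
      using assms(6) nrm_at_top unfolding reduced_rep_def by blast
  qed simp
qed

end
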